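(* Let $r\ge 2$ be an integer, $n\ge 3r^2$, and $0\le\delta\le 10^{-7}r^{-12}$. If $G$ is an $n$-vertex graph containing no copy of $K_{r+1}$ such that $\lambda(G)\ge\left(1-\frac1r-\delta\right)n$, then $$D_r(G)\le\left(\frac{2r}{3\sqrt3}+o_\delta(1)\right)\delta^{3/2}n^2,$$ where $o_\delta(1)$ denotes a term (depending on $r$ and $\delta$ only) that tends to $0$ as $\delta\to0$.
   Context: $\lambda(G)$ is the spectral radius (largest eigenvalue) of the adjacency matrix of $G$. $K_{r+1}$ is the complete graph on $r+1$ vertices. For a graph $G$, $D_r(G)$ is the minimum number of edges that must be removed from $G$ to make it $r$-partite (i.e. $r$-colorable). *)

theory Defs
  imports Complex_Main "Jordan_Normal_Form.Char_Poly"
begin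

definition simple_graph :: "nat \<Rightarrow> (nat \<Rightarrow> nat \<Rightarrow> bool) \<Rightarrow> bool" where
  "simple_graph n E \<longleftrightarrow> (\<forall>i j. E i j \<longrightarrow> E j i) \<and> (\<forall>i. \<not> E i i)
     \<and> (\<forall>i j. E i j \<longrightarrow> i < n \<and> j < n)"

definition graph_edges :: "(nat \<Rightarrow> nat \<Rightarrow> bool) \<Rightarrow> nat set set" where
  "graph_edges E = {{i, j} | i j. E i j}"

definition adj_mat :: "nat \<Rightarrow> (nat \<Rightarrow> nat \<Rightarrow> bool) \<Rightarrow> real mat" where
  "adj_mat n E = mat n n (\<lambda>(i, j). if E i j then 1 else 0)"

definition spec_rad :: "nat \<Rightarrow> (nat \<Rightarrow> nat \<Rightarrow> bool) \<Rightarrow> real" where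
  "spec_rad n E = Max {\<mu>. eigenvalue (adj_mat n E) \<mu>}"

definition contains_clique :: "nat \<Rightarrow> (nat \<Rightarrow> nat \<Rightarrow> bool) \<Rightarrow> nat \<Rightarrow> bool" where
  "contains_clique n E k \<longleftrightarrow>
     (\<exists>S. S \<subseteq> {0..<n} \<and> card S = k \<and> (\<forall>i\<in>S. \<forall>j\<in>S. i \<noteq> j \<longrightarrow> E i j))"

definition D_r :: "nat \<Rightarrow> (nat \<Rightarrow> nat \<Rightarrow> bool) \<Rightarrow> nat \<Rightarrow> nat" where
  "D_r n E r = Min {card F | F. F \<subseteq> graph_edges E \<and>
     (\<exists>c :: nat \<Rightarrow> nat. (\<forall>i<n. c i < r) \<and>
        (\<forall>i j. E i j \<and> {i, j} \<notin> F \<longrightarrow> c i \<noteq> c j))}"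

end

theory Submission
  imports Defs "Jordan_Normal_Form.Spectral_Radius"
begin

text \<open>
  Cauchy--Schwarz and the Motzkin--Straus inequality for the squared entries of an eigenvector give
  $\lambda(G)^2 \le 2 (1 - 1/r) e(G)$, so $e(G) \ge (1 - 1/r) n^2 / 2 - \delta n^2$, and by Furedi's
  argument some $r$-colouring has at most $\delta n^2$ monochromatic edges. Take a colouring with the
  fewest monochromatic edges; it is nearly balanced and misses $O(\delta n^2)$ cross pairs.

  Put $s = \delta^{1/4}$. Every monochromatic edge has an endpoint missing at least $n/4r$ cross
  pairs, and there are $O(s^4 n)$ such vertices. Those with at least $s n$ neighbours in every other
  class have $O(s^3 n)$ neighbours in their own class and contribute only $O(s^7 n^2)$ edges. The
  remaining $b n$ vertices each miss about $n/r$ cross pairs. If such a vertex has $a n$ neighbours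
  in its own class, then by minimality it has as many in each class, and since there is no clique
  on $r$ of these neighbours, at least $a^2 n^2$ cross pairs among them are missing. Hence
  $a^2 + b/r \le \delta (1 + O(s))$, and the number of monochromatic edges is at most
  $a b n^2 + O(s^7 n^2)$; maximising $r a (\delta - a^2)$ at $a = \sqrt{\delta/3}$ yields the
  constant.
\<close>

section \<open>Spectral radius and number of edges\<close>

text \<open>The spectral radius is a \<open>Max\<close> over real eigenvalues, so that set must be
  nonempty. A complex eigenvalue always exists, and it is real because the Hermitian form of a real
  symmetric matrix takes real values.\<close>

lemma symmetric_eigenvalue_exists:
  fixes A :: "real mat"
  assumes A: "A \<in> carrier_mat n n" and n: "n > 0"
    and sym: "\<And>i j. i < n \<Longrightarrow> j < n \<Longrightarrow> A $$ (i, j) = A $$ (j, i)"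
  shows "\<exists>k. eigenvalue A k"
proof -
  let ?C = "map_mat complex_of_real A"
  have C: "?C \<in> carrier_mat n n" using A by simp
  obtain k where k: "eigenvalue ?C k"
    using spectrum_non_empty[OF C n] unfolding spectrum_def by auto
  then obtain v where v: "v \<in> carrier_vec n" "v \<noteq> 0\<^sub>v n" "?C *\<^sub>v v = k \<cdot>\<^sub>v v"
    using A unfolding eigenvalue_def eigenvector_def by auto
  have row: "(\<Sum>j<n. of_real (A $$ (i, j)) * v $ j) = k * v $ i" if "i < n" for i
  proof -
    have "(?C *\<^sub>v v) $ i = (\<Sum>j<n. of_real (A $$ (i, j)) * v $ j)"
      using that A v(1) by (auto simp: scalar_prod_def atLeast0LessThan intro!: sum.cong)
    then show ?thesis using v that by simp
  qed
  define S where "S = (\<Sum>i<n. (cmod (v $ i))\<^sup>2)"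
  define Q where "Q = (\<Sum>i<n. \<Sum>j<n. of_real (A $$ (i, j)) * cnj (v $ i) * v $ j)"
  have Q: "Q = k * of_real S"
  proof -
    have "Q = (\<Sum>i<n. cnj (v $ i) * (\<Sum>j<n. of_real (A $$ (i, j)) * v $ j))"
      unfolding Q_def by (simp add: sum_distrib_left mult_ac)
    also have "\<dots> = (\<Sum>i<n. k * of_real ((cmod (v $ i))\<^sup>2))"
    proof (intro sum.cong refl)
      fix i assume "i \<in> {..<n}"
      then have "cnj (v $ i) * (\<Sum>j<n. of_real (A $$ (i, j)) * v $ j) = cnj (v $ i) * (k * v $ i)"
        by (simp only: row lessThan_iff)
      then show "cnj (v $ i) * (\<Sum>j<n. of_real (A $$ (i, j)) * v $ j) = k * of_real ((cmod (v $ i))\<^sup>2)"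
        unfolding complex_norm_square by (simp only: mult_ac)
    qed
    finally show ?thesis by (simp add: S_def sum_distrib_left)
  qed
  have "cnj Q = (\<Sum>i<n. \<Sum>j<n. of_real (A $$ (j, i)) * cnj (v $ j) * v $ i)"
    unfolding Q_def by (auto simp: sym intro!: sum.cong)
  also have "\<dots> = Q" unfolding Q_def by (rule sum.swap)
  finally have real: "cnj k * of_real S = k * of_real S" using Q by simp
  obtain i where "i < n" "v $ i \<noteq> 0"
    using v(1,2) by (metis carrier_vecD eq_vecI index_zero_vec)
  then have "S > 0" unfolding S_def by (intro sum_pos2[of _ i]) auto
  then have "k \<in> \<real>" using real by (simp add: Reals_cnj_iff)
  then obtain x where x: "k = of_real x" by (auto elim: Reals_cases)
  have "poly (map_poly of_real (char_poly A)) (complex_of_real x) = 0"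
    using k eigenvalue_root_char_poly[OF C] of_real_hom.char_poly_hom[OF A] x by metis
  then have "poly (char_poly A) x = 0" by simp
  then show ?thesis using eigenvalue_root_char_poly[OF A] by blast
qed

text \<open>The \<open>Max\<close> is attained, the eigenvalue set being finite and nonempty. The
  row equations carry the eigenvector on without matrices.\<close>

lemma spec_rad_eigenvector:
  assumes n: "n > 0" and sym: "\<And>i j. E i j \<Longrightarrow> E j i"
  shows "\<exists>x. (\<exists>i<n. x i \<noteq> 0) \<and> (\<forall>i<n. (\<Sum>j<n. of_bool (E i j) * x j) = spec_rad n E * x i)"
proof -
  let ?A = "adj_mat n E"
  have A: "?A \<in> carrier_mat n n" by (simp add: adj_mat_def)
  have "\<exists>k. eigenvalue ?A k"
    by (rule symmetric_eigenvalue_exists[OF A n]) (auto simp: adj_mat_def dest: sym)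
  moreover have "finite {k. eigenvalue ?A k}"
    using card_finite_spectrum(1)[OF A] by (simp add: spectrum_def)
  ultimately have "eigenvalue ?A (spec_rad n E)"
    unfolding spec_rad_def using Max_in[of "{k. eigenvalue ?A k}"] by auto
  then obtain v where v: "v \<in> carrier_vec n" "v \<noteq> 0\<^sub>v n" "?A *\<^sub>v v = spec_rad n E \<cdot>\<^sub>v v"
    using A unfolding eigenvalue_def eigenvector_def by auto
  have "(\<Sum>j<n. of_bool (E i j) * v $ j) = spec_rad n E * v $ i" if "i < n" for i
  proof -
    have "(?A *\<^sub>v v) $ i = (\<Sum>j<n. of_bool (E i j) * v $ j)"
      using that v(1)
      by (simp add: adj_mat_def scalar_prod_def atLeast0LessThan of_bool_def)
    then show ?thesis using v that by simp
  qed
  moreover have "\<exists>i<n. v $ i \<noteq> 0"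
    using v(1,2) by (metis carrier_vecD eq_vecI index_zero_vec)
  ultimately show ?thesis by blast
qed

text \<open>Erdos' degree majorisation: the class of a vertex of maximal weighted degree is its
  non-neighbourhood, and the remaining vertices are coloured recursively. The weights
  \<open>y = 1\<close> give Furedi's stability bound, the squared entries of an eigenvector the
  Motzkin--Straus inequality.\<close>
lemma weighted_colouring:
  fixes E :: "'a \<Rightarrow> 'a \<Rightarrow> bool" and y :: "'a \<Rightarrow> real"
  assumes sym: "\<And>i j. E i j \<Longrightarrow> E j i" and irr: "\<And>i. \<not> E i i" and y: "\<And>i. y i \<ge> 0"
  assumes "finite W"
    and "\<And>S. S \<subseteq> W \<Longrightarrow> card S = Suc r \<Longrightarrow> \<exists>i\<in>S. \<exists>j\<in>S. i \<noteq> j \<and> \<not> E i j"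
  shows "\<exists>c :: 'a \<Rightarrow> nat. (\<forall>i\<in>W. c i < r) \<and>
    (\<Sum>i\<in>W. \<Sum>j\<in>W. of_bool (E i j) * (1 + of_bool (c i = c j)) * y i * y j)
      \<le> (1 - 1 / real r) * (\<Sum>i\<in>W. y i)\<^sup>2"
  using assms(4,5)
proof (induction r arbitrary: W)
  case 0
  \<comment> \<open>A single vertex is a clique of size 1, so none is left and both sides
    vanish.\<close>
  have "W = {}"
  proof (rule ccontr)
    assume "W \<noteq> {}"
    then obtain x where "x \<in> W" by auto
    then show False using 0(2)[of "{x}"] by auto
  qed
  then show ?case by simp
next
  case (Suc r)
  show ?case
  proof (cases "W = {}")
    case True
    then show ?thesis by simp
  next
    case False
    define d where "d v = (\<Sum>j\<in>W. of_bool (E v j) * y j)" for v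
    have "Max (d ` W) \<in> d ` W" using False Suc.prems by (intro Max_in) auto
    then obtain x where x: "x \<in> W" "d x = Max (d ` W)" by auto
    have dmax: "d v \<le> d x" if "v \<in> W" for v
      using x that Suc.prems by simp
    define N where "N = {j\<in>W. E x j}"
    define V where "V = W - N"
    have fin: "finite N" "finite V" "N \<inter> V = {}" "W = N \<union> V" "N \<subseteq> W" "V \<subseteq> W"
      using Suc.prems unfolding N_def V_def by auto
    have split: "(\<Sum>i\<in>W. f i) = (\<Sum>i\<in>N. f i) + (\<Sum>i\<in>V. f i)" for f :: "'a \<Rightarrow> real"
      using fin by (simp add: sum.union_disjoint)
    \<comment> \<open>A clique of size \<open>r + 1\<close> inside \<open>N\<close> would extend by
      \<open>x\<close> to a forbidden one.\<close>
    have "\<exists>i\<in>S. \<exists>j\<in>S. i \<noteq> j \<and> \<not> E i j" if S: "S \<subseteq> N" "card S = Suc r" for S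
    proof -
      have "x \<notin> S" using S irr unfolding N_def by blast
      moreover have "finite S" using S(1) fin(1) by (rule finite_subset)
      ultimately have "card (insert x S) = Suc (Suc r)" using S by simp
      moreover have "insert x S \<subseteq> W" using x S fin by blast
      ultimately obtain i j where
        "i \<in> insert x S" "j \<in> insert x S" "i \<noteq> j" "\<not> E i j"
        using Suc.prems(2) by meson
      moreover have "E x k" "E k x" if "k \<in> S" for k using that S sym unfolding N_def by blast+
      ultimately show ?thesis by blast
    qed
    from Suc.IH[OF fin(1) this] obtain c where c: "\<forall>i\<in>N. c i < r"
      "(\<Sum>i\<in>N. \<Sum>j\<in>N. of_bool (E i j) * (1 + of_bool (c i = c j)) * y i * y j)
        \<le> (1 - 1 / real r) * (\<Sum>i\<in>N. y i)\<^sup>2" by blast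
    \<comment> \<open>The non-neighbourhood \<open>V\<close> of \<open>x\<close> gets the new colour
      \<open>r\<close>. Edges inside \<open>V\<close> then carry the factor 2, so the pairs meeting
      \<open>V\<close> contribute exactly twice its weighted degree sum.\<close>
    define c' where "c' i = (if i \<in> N then c i else r)" for i
    define g where "g i j = of_bool (E i j) * (1 + of_bool (c' i = c' j)) * y i * y j" for i j
    define D where "D = (\<Sum>i\<in>N. y i)"
    define Y where "Y = (\<Sum>i\<in>W. y i)"
    have Dd: "d x = D" unfolding d_def D_def N_def
      using Suc.prems by (simp add: sum.inter_filter of_bool_def if_distrib if_distribR cong: if_cong)
    have YV: "(\<Sum>i\<in>V. y i) = Y - D" unfolding Y_def D_def split by simp
    have NN: "(\<Sum>i\<in>N. \<Sum>j\<in>N. g i j) \<le> (1 - 1 / real r) * D\<^sup>2"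
      using c(2) by (simp add: g_def c'_def D_def)
    have notin: "i \<notin> N" if "i \<in> V" for i using that by (simp add: V_def)
    have c'N: "c' i < r" if "i \<in> N" for i using that c(1) by (simp add: c'_def)
    have c'V: "c' i = r" if "i \<in> V" for i using notin[OF that] by (simp add: c'_def)
    have gVN: "g i j = of_bool (E i j) * y i * y j" if "i \<in> V" "j \<in> N" for i j
      using c'V[OF that(1)] c'N[OF that(2)] by (simp add: g_def)
    have gNV: "g i j = of_bool (E j i) * y j * y i" if "i \<in> N" "j \<in> V" for i j
      using c'N[OF that(1)] c'V[OF that(2)] sym by (auto simp: g_def)
    have VN: "(\<Sum>i\<in>V. \<Sum>j\<in>N. g i j) = (\<Sum>i\<in>V. \<Sum>j\<in>N. of_bool (E i j) * y i * y j)"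
      by (intro sum.cong refl gVN)
    have NV: "(\<Sum>i\<in>N. \<Sum>j\<in>V. g i j) = (\<Sum>i\<in>V. \<Sum>j\<in>N. of_bool (E i j) * y i * y j)"
    proof -
      have "(\<Sum>i\<in>N. \<Sum>j\<in>V. g i j) = (\<Sum>j\<in>V. \<Sum>i\<in>N. g i j)" by (rule sum.swap)
      also have "\<dots> = (\<Sum>j\<in>V. \<Sum>i\<in>N. of_bool (E j i) * y j * y i)"
        by (intro sum.cong refl gNV)
      finally show ?thesis .
    qed
    have VV: "(\<Sum>i\<in>V. \<Sum>j\<in>V. g i j) = 2 * (\<Sum>i\<in>V. \<Sum>j\<in>V. of_bool (E i j) * y i * y j)"
      unfolding sum_distrib_left
      by (intro sum.cong refl) (simp add: g_def c'V)
    have deg: "(\<Sum>i\<in>V. y i * d i) = (\<Sum>i\<in>V. \<Sum>j\<in>N. of_bool (E i j) * y i * y j)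
        + (\<Sum>i\<in>V. \<Sum>j\<in>V. of_bool (E i j) * y i * y j)"
      unfolding d_def split by (simp add: sum.distrib sum_distrib_left algebra_simps)
    have "(\<Sum>i\<in>W. \<Sum>j\<in>W. g i j) = (\<Sum>i\<in>N. \<Sum>j\<in>N. g i j) + 2 * (\<Sum>i\<in>V. y i * d i)"
      using NV VN VV unfolding split deg by (simp add: sum.distrib)
    moreover have "(\<Sum>i\<in>V. y i * d i) \<le> (\<Sum>i\<in>V. y i * D)"
      using dmax y fin by (intro sum_mono mult_left_mono) (auto simp flip: Dd)
    moreover have "(\<Sum>i\<in>V. y i * D) = (Y - D) * D"
      using YV by (simp flip: sum_distrib_right)
    ultimately have main: "(\<Sum>i\<in>W. \<Sum>j\<in>W. g i j) \<le> (1 - 1 / real r) * D\<^sup>2 + 2 * ((Y - D) * D)"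
      using NN by linarith
    have "(1 - 1 / real r) * D\<^sup>2 + 2 * ((Y - D) * D) \<le> (1 - 1 / real (Suc r)) * Y\<^sup>2"
    \<comment> \<open>With \<open>r = 0\<close> the set \<open>N\<close> is empty and
      \<open>D = 0\<close>. Otherwise the difference of the two sides is a square vanishing at
      \<open>D = r / (r + 1) * Y\<close>.\<close>
    proof (cases "r = 0")
      case True
      then have "N = {}" using c(1) by auto
      then show ?thesis using True by (simp add: D_def)
    next
      case False
      then have r: "real r > 0" by simp
      have "(1 - 1 / real (Suc r)) * Y\<^sup>2 - ((1 - 1 / real r) * D\<^sup>2 + 2 * ((Y - D) * D))
        = (real r * Y - (real r + 1) * D)\<^sup>2 / (real r * (real r + 1))"
        using r by (simp add: field_simps power2_eq_square)
      moreover have "\<dots> \<ge> 0" using r by simp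
      ultimately show ?thesis by linarith
    qed
    then have "(\<Sum>i\<in>W. \<Sum>j\<in>W. g i j) \<le> (1 - 1 / real (Suc r)) * Y\<^sup>2" using main by linarith
    moreover have "\<forall>i\<in>W. c' i < Suc r" using c(1) by (auto simp: c'_def less_SucI)
    ultimately show ?thesis unfolding g_def Y_def by blast
  qed
qed

text \<open>Cauchy-Schwarz over the pairs weighted by \<open>A\<close> gives
  \<open>(l * S)\<^sup>2 \<le> q * w\<close>, with \<open>S\<close> the squared norm of the
  eigenvector; the Motzkin--Straus hypothesis \<open>ms\<close> bounds \<open>w\<close> by
  \<open>g * S\<^sup>2\<close>.\<close>

lemma spectral_edge_bound:
  fixes A :: "'a \<Rightarrow> 'a \<Rightarrow> real"
  assumes "finite W" and A: "\<And>i j. A i j = 0 \<or> A i j = 1"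
    and eig: "\<And>i. i \<in> W \<Longrightarrow> (\<Sum>j\<in>W. A i j * x j) = l * x i"
    and ms: "(\<Sum>i\<in>W. \<Sum>j\<in>W. A i j * (x i)\<^sup>2 * (x j)\<^sup>2) \<le> g * (\<Sum>i\<in>W. (x i)\<^sup>2)\<^sup>2"
    and nz: "\<exists>i\<in>W. x i \<noteq> 0"
  shows "l\<^sup>2 \<le> g * (\<Sum>i\<in>W. \<Sum>j\<in>W. A i j)"
proof -
  define S where "S = (\<Sum>i\<in>W. (x i)\<^sup>2)"
  define q where "q = (\<Sum>i\<in>W. \<Sum>j\<in>W. A i j)"
  define w where "w = (\<Sum>i\<in>W. \<Sum>j\<in>W. A i j * (x i)\<^sup>2 * (x j)\<^sup>2)"
  have S: "S > 0" unfolding S_def using nz assms(1) by (metis sum_pos2 zero_le_power2 zero_less_power2)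
  have A0: "A i j \<ge> 0" for i j using A[of i j] by auto
  have p: "(\<Sum>i\<in>W. \<Sum>j\<in>W. A i j * (x i * x j)) = l * S"
  proof -
    have "(\<Sum>i\<in>W. \<Sum>j\<in>W. A i j * (x i * x j)) = (\<Sum>i\<in>W. x i * (\<Sum>j\<in>W. A i j * x j))"
      by (simp add: sum_distrib_left mult_ac)
    also have "\<dots> = (\<Sum>i\<in>W. l * (x i)\<^sup>2)"
      by (intro sum.cong refl) (simp add: eig power2_eq_square)
    finally show ?thesis by (simp add: S_def sum_distrib_left)
  qed
  \<comment> \<open>Cauchy-Schwarz via a nonnegative quadratic in \<open>t\<close>. Taken at
    \<open>t = l * S\<close> it carries an extra factor \<open>q\<close>, cancelled below unless
    \<open>q = 0\<close>.\<close>
  have "0 \<le> (\<Sum>i\<in>W. \<Sum>j\<in>W. A i j * (t - q * (x i * x j))\<^sup>2)" for t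
    using A0 by (intro sum_nonneg) simp
  also have "(\<Sum>i\<in>W. \<Sum>j\<in>W. A i j * (t - q * (x i * x j))\<^sup>2)
      = t\<^sup>2 * (\<Sum>i\<in>W. \<Sum>j\<in>W. A i j) - 2 * q * t * (\<Sum>i\<in>W. \<Sum>j\<in>W. A i j * (x i * x j))
        + q\<^sup>2 * (\<Sum>i\<in>W. \<Sum>j\<in>W. A i j * (x i)\<^sup>2 * (x j)\<^sup>2)" for t
    unfolding sum_distrib_left sum.distrib[symmetric] sum_subtractf[symmetric]
    by (intro sum.cong refl) (simp add: power2_eq_square algebra_simps)
  finally have "0 \<le> (l * S)\<^sup>2 * q - 2 * q * (l * S) * (l * S) + q\<^sup>2 * w"
    unfolding p q_def[symmetric] w_def[symmetric] .
  then have cs: "0 \<le> q * (q * w - (l * S)\<^sup>2)" by (simp add: power2_eq_square algebra_simps)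
  have "q \<ge> 0" unfolding q_def using A0 by (intro sum_nonneg)
  have "(l * S)\<^sup>2 \<le> q * w"
  proof (cases "q = 0")
    case True
    then have "A i j = 0" if "i \<in> W" "j \<in> W" for i j
      using that A0 assms(1) unfolding q_def
      by (metis (no_types, lifting) sum_nonneg sum_nonneg_eq_0_iff)
    then have "l * S = 0" unfolding p[symmetric] by simp
    then show ?thesis using True by simp
  next
    case False
    then show ?thesis using cs \<open>q \<ge> 0\<close> by (simp add: zero_le_mult_iff)
  qed
  also have "\<dots> \<le> q * (g * S\<^sup>2)"
    using ms \<open>q \<ge> 0\<close> unfolding w_def S_def by (rule mult_left_mono)
  finally have "l\<^sup>2 * S\<^sup>2 \<le> (g * q) * S\<^sup>2" by (simp add: power_mult_distrib mult_ac)
  then show ?thesis unfolding q_def[symmetric] using S by simp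
qed

section \<open>Missing cross pairs of a colouring\<close>

text \<open>Double counting: every transversal contains a non-edge, and a fixed non-edge between two of
  the classes lies in at most a fraction \<open>1 / P\<close> of all transversals.\<close>
lemma transversal_nonedges:
  fixes X :: "nat \<Rightarrow> 'a set" and c :: "'a \<Rightarrow> nat"
  assumes U: "finite U" and K: "finite K" "K \<noteq> {}"
    and X: "\<And>k. k \<in> K \<Longrightarrow> X k \<subseteq> {u\<in>U. c u = k}"
    and ne: "\<And>k. k \<in> K \<Longrightarrow> X k \<noteq> {}"
    and P: "\<And>k l. k \<in> K \<Longrightarrow> l \<in> K \<Longrightarrow> k \<noteq> l \<Longrightarrow> P \<le> real (card (X k)) * real (card (X l))"
    and sym: "\<And>i j. E i j \<Longrightarrow> E j i"
    and no: "\<And>\<phi>. (\<And>k. k \<in> K \<Longrightarrow> \<phi> k \<in> X k) \<Longrightarrow> \<exists>k\<in>K. \<exists>l\<in>K. k \<noteq> l \<and> \<not> E (\<phi> k) (\<phi> l)"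
  shows "P \<le> real (card {(x, y). x \<in> U \<and> y \<in> U \<and> c x < c y \<and> \<not> E x y})"
proof (cases "P \<le> 0")
  case True
  then show ?thesis by (meson of_nat_0_le_iff order_trans)
next
  case False
  define Z where "Z = PiE K X"
  define M where "M = {(x, y). x \<in> U \<and> y \<in> U \<and> c x < c y \<and> \<not> E x y}"
  \<comment> \<open>\<open>M'\<close> keeps the non-edges between classes indexed by
    \<open>K\<close>; \<open>F m\<close> collects the transversals through both ends of
    \<open>m\<close>.\<close>
  define M' where "M' = {m\<in>M. c (fst m) \<in> K \<and> c (snd m) \<in> K}"
  define F where "F m = {\<phi>\<in>Z. \<phi> (c (fst m)) = fst m \<and> \<phi> (c (snd m)) = snd m}" for m
  have finX: "finite (X k)" if "k \<in> K" for k
  proof (rule finite_subset[OF _ U])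
    show "X k \<subseteq> U" using X[OF that] by auto
  qed
  have finZ: "finite Z" unfolding Z_def using K(1) finX by (rule finite_PiE)
  have cardZ: "card Z = (\<Prod>k\<in>K. card (X k))" unfolding Z_def using K(1) by (rule card_PiE)
  have Zpos: "card Z > 0" unfolding cardZ using ne finX by (intro prod_pos) (auto simp: card_gt_0_iff)
  have "finite (U \<times> U)" using U by simp
  then have finM: "finite M" by (rule finite_subset[rotated]) (auto simp: M_def)
  then have finM': "finite M'" by (simp add: M'_def)
  have cover: "Z \<subseteq> (\<Union>m\<in>M'. F m)"
  proof
    fix \<phi> assume \<phi>: "\<phi> \<in> Z"
    then have in_X: "\<phi> k \<in> X k" if "k \<in> K" for k using that by (auto simp: Z_def)
    then have in_U: "\<phi> k \<in> U" "c (\<phi> k) = k" if "k \<in> K" for k using X[OF that] that by auto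
    from no[OF in_X] obtain k l where kl: "k \<in> K" "l \<in> K" "k < l" "\<not> E (\<phi> k) (\<phi> l)"
      using sym by (metis linorder_neqE_nat)
    then have "(\<phi> k, \<phi> l) \<in> M'" "\<phi> \<in> F (\<phi> k, \<phi> l)"
      using \<phi> in_U by (auto simp: M'_def M_def F_def)
    then show "\<phi> \<in> (\<Union>m\<in>M'. F m)" by blast
  qed
  \<comment> \<open>A transversal through \<open>m\<close> is determined by its values at the other
    colours, whereas \<open>card Z\<close> has the further factor
    \<open>card (X k) * card (X l)\<close>, which is at least \<open>P\<close>.\<close>
  have bound: "P * real (card (F m)) \<le> real (card Z)" if "m \<in> M'" for m
  proof -
    define k l where "k = c (fst m)" and "l = c (snd m)"
    have kl: "k \<in> K" "l \<in> K" "k \<noteq> l" using that by (auto simp: M'_def M_def k_def l_def)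
    let ?R = "K - {k} - {l}"
    have "card (F m) \<le> card (PiE ?R X)"
    proof (rule card_inj_on_le)
      show "inj_on (\<lambda>\<phi>. restrict \<phi> ?R) (F m)"
      proof (rule inj_onI)
        fix \<phi> \<psi> assume h: "\<phi> \<in> F m" "\<psi> \<in> F m" "restrict \<phi> ?R = restrict \<psi> ?R"
        have "\<phi> i = \<psi> i" if "i \<in> K" for i
        proof (cases "i \<in> ?R")
          case True
          then show ?thesis using h(3) by (metis restrict_apply')
        next
          case False
          then have "i = k \<or> i = l" using that by auto
          then show ?thesis using h(1,2) by (auto simp: F_def k_def l_def)
        qed
        then show "\<phi> = \<psi>" using h(1,2) unfolding F_def Z_def by (blast intro: PiE_ext)
      qed
      show "(\<lambda>\<phi>. restrict \<phi> ?R) ` F m \<subseteq> PiE ?R X"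
        unfolding image_subset_iff restrict_PiE_iff by (auto simp: F_def Z_def)
      show "finite (PiE ?R X)" using K(1) finX by (intro finite_PiE) auto
    qed
    also have "card (PiE ?R X) = (\<Prod>i\<in>?R. card (X i))" using K(1) by (simp add: card_PiE)
    finally have F: "card (F m) \<le> (\<Prod>i\<in>?R. card (X i))" .
    have "card Z = card (X k) * (card (X l) * (\<Prod>i\<in>?R. card (X i)))"
      unfolding cardZ using kl K(1)
      by (subst prod.remove[of _ k]) (auto simp: prod.remove[of "K - {k}" l])
    then have Zeq: "real (card Z) = (real (card (X k)) * real (card (X l))) * real (\<Prod>i\<in>?R. card (X i))"
      by simp
    show ?thesis unfolding Zeq
      using P[OF kl] F False by (intro mult_mono) (simp_all del: of_nat_prod)
  qed
  have "finite (\<Union>m\<in>M'. F m)" using finZ by (rule finite_subset[rotated]) (auto simp: F_def)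
  then have "card Z \<le> (\<Sum>m\<in>M'. card (F m))"
    using card_mono[OF _ cover] card_UN_le[OF finM', of F] by (meson order_trans)
  then have "real (card Z) \<le> (\<Sum>m\<in>M'. real (card (F m)))" by (simp flip: of_nat_sum)
  then have "P * real (card Z) \<le> P * (\<Sum>m\<in>M'. real (card (F m)))"
    using False by (intro mult_left_mono) auto
  also have "\<dots> \<le> real (card M') * real (card Z)"
    unfolding sum_distrib_left using sum_mono[of M', OF bound] by simp
  finally have "P \<le> real (card M')" using Zpos by simp
  also have "\<dots> \<le> real (card M)" using finM by (auto simp: M'_def intro: card_mono)
  finally show ?thesis by (simp add: M_def)
qed

text \<open>Halves counts of ordered pairs: \<open>c\<close> will be the colouring for gaps and the
  identity for monochromatic edges.\<close>

lemma card_symmetric_pairs: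
  fixes c :: "'a \<Rightarrow> 'b :: linorder"
  assumes "finite R" and sym: "\<And>x y. (x, y) \<in> R \<Longrightarrow> (y, x) \<in> R"
    and ne: "\<And>x y. (x, y) \<in> R \<Longrightarrow> c x \<noteq> c y"
  shows "card R = 2 * card {(x, y)\<in>R. c x < c y}"
proof -
  let ?A = "{(x, y)\<in>R. c x < c y}"
  have fin: "finite ?A" using assms(1) by (rule finite_subset[rotated]) auto
  have "R = ?A \<union> prod.swap ` ?A"
    using sym ne by (fastforce simp: image_iff)
  moreover have "?A \<inter> prod.swap ` ?A = {}" by auto
  ultimately have "card R = card ?A + card (prod.swap ` ?A)"
    using fin by (metis (no_types, lifting) card_Un_disjoint finite_imageI)
  also have "card (prod.swap ` ?A) = card ?A" by (rule card_image) simp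
  finally show ?thesis by simp
qed

section \<open>Counting pairs in a coloured graph\<close>

locale coloured_graph =
  fixes n r :: nat and E :: "nat \<Rightarrow> nat \<Rightarrow> bool" and c :: "nat \<Rightarrow> nat"
  assumes graph: "simple_graph n E"
    and colour: "i < n \<Longrightarrow> c i < r"
begin

text \<open>The sets \<open>inner\<close> and \<open>gaps\<close> contain ordered pairs, so they count every edge and every
  missing cross pair twice.\<close>
definition part :: "nat \<Rightarrow> nat set" where "part l = {i. i < n \<and> c i = l}"
definition nbrs :: "nat \<Rightarrow> nat \<Rightarrow> nat set" where "nbrs v l = {u\<in>part l. E v u}"
definition gap :: "nat \<Rightarrow> nat set" where "gap v = {u. u < n \<and> c u \<noteq> c v \<and> \<not> E v u}"
definition inner :: "(nat \<times> nat) set" where "inner = {(i, j). E i j \<and> c i = c j}"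
definition gaps :: "nat set \<Rightarrow> (nat \<times> nat) set" where
  "gaps U = {(x, y). x \<in> U \<and> y \<in> U \<and> c x \<noteq> c y \<and> \<not> E x y}"

lemma E_sym: "E i j \<Longrightarrow> E j i" and E_irrefl: "\<not> E i i" and E_less: "E i j \<Longrightarrow> i < n \<and> j < n"
  using graph by (auto simp: simple_graph_def)

lemma finite_sets [simp]: "finite (part l)" "finite (nbrs v l)" "finite (gap v)"
  by (auto simp: part_def nbrs_def gap_def)

lemma finite_pairs: "R \<subseteq> {..<n} \<times> {..<n} \<Longrightarrow> finite R"
  by (rule finite_subset) auto

lemma finite_inner: "finite inner"
  by (rule finite_pairs) (auto simp: inner_def dest: E_less)

lemma finite_gaps: "U \<subseteq> {..<n} \<Longrightarrow> finite (gaps U)"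
  by (rule finite_pairs) (auto simp: gaps_def)

lemma sum_card_part: "(\<Sum>l<r. card (part l)) = n"
proof -
  have "card (\<Union>l<r. part l) = (\<Sum>l<r. card (part l))"
    by (rule card_UN_disjoint) (auto simp: part_def)
  moreover have "(\<Union>l<r. part l) = {..<n}" using colour by (auto simp: part_def)
  ultimately show ?thesis by simp
qed

text \<open>Ordered vertex pairs split into cross edges, gaps and pairs inside a class; adding
  \<open>inner\<close> on both sides completes the cross edges to all edges.\<close>

lemma pair_count:
  "(real n)\<^sup>2 + real (card inner) =
    real (card {(i, j). E i j}) + real (card (gaps {..<n})) + (\<Sum>l<r. (real (card (part l)))\<^sup>2)"
proof -
  define cross where "cross = {(i, j). E i j \<and> c i \<noteq> c j}"
  define same where "same = (\<Union>l<r. part l \<times> part l)"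
  have fin: "finite cross" "finite same" "finite (gaps {..<n})"
    by (rule finite_pairs; auto simp: cross_def same_def gaps_def part_def dest: E_less)+
  have "card same = (\<Sum>l<r. card (part l \<times> part l))"
    unfolding same_def by (rule card_UN_disjoint) (auto simp: part_def)
  then have same: "real (card same) = (\<Sum>l<r. (real (card (part l)))\<^sup>2)"
    by (simp add: card_cartesian_product power2_eq_square)
  have "{..<n} \<times> {..<n} = (cross \<union> gaps {..<n}) \<union> same"
    using colour by (auto simp: cross_def gaps_def same_def part_def dest: E_less)
  then have "card ({..<n} \<times> {..<n}) = card ((cross \<union> gaps {..<n}) \<union> same)" by simp
  also have "\<dots> = card (cross \<union> gaps {..<n}) + card same"
    using fin by (intro card_Un_disjoint) (auto simp: cross_def gaps_def same_def part_def)
  also have "card (cross \<union> gaps {..<n}) = card cross + card (gaps {..<n})"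
    using fin by (intro card_Un_disjoint) (auto simp: cross_def gaps_def)
  finally have sq: "n * n = card cross + card (gaps {..<n}) + card same"
    by (simp add: card_cartesian_product)
  have "{(i, j). E i j} = cross \<union> inner" by (auto simp: cross_def inner_def)
  moreover have "card (cross \<union> inner) = card cross + card inner"
    using fin finite_inner by (intro card_Un_disjoint) (auto simp: cross_def inner_def)
  ultimately have "real (card {(i, j). E i j}) = real (card cross) + real (card inner)" by simp
  moreover have "(real n)\<^sup>2 = real (card cross) + real (card (gaps {..<n})) + real (card same)"
    unfolding power2_eq_square of_nat_mult[symmetric] sq by simp
  ultimately show ?thesis using same by linarith
qed

text \<open>Both terms on the left are nonnegative, so a dense graph with few monochromatic edges
  has few gaps and nearly equal classes.\<close>

lemma variance_count:
  assumes "r > 0"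
  shows "real (card (gaps {..<n})) + (\<Sum>l<r. (real (card (part l)) - real n / real r)\<^sup>2)
    = real (card inner) + (1 - 1 / real r) * (real n)\<^sup>2 - real (card {(i, j). E i j})"
proof -
  have "(\<Sum>l<r. (real (card (part l)) - real n / real r)\<^sup>2)
      = (\<Sum>l<r. (real (card (part l)))\<^sup>2) - 2 * (real n / real r) * (\<Sum>l<r. real (card (part l)))
        + real r * (real n / real r)\<^sup>2"
    by (simp add: power2_diff sum.distrib sum_subtractf sum_distrib_left mult_ac)
  also have "(\<Sum>l<r. real (card (part l))) = real n"
    by (simp add: sum_card_part flip: of_nat_sum)
  also have "2 * (real n / real r) * real n = 2 * ((real n)\<^sup>2 / real r)"
    by (simp add: power2_eq_square)
  also have "real r * (real n / real r)\<^sup>2 = (real n)\<^sup>2 / real r"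
    using assms by (simp add: power2_eq_square)
  finally show ?thesis using pair_count by (simp add: algebra_simps)
qed

lemma card_gaps_sum: "card (gaps {..<n}) = (\<Sum>v<n. card (gap v))"
proof -
  have "gaps {..<n} = Sigma {..<n} gap" by (auto simp: gaps_def gap_def)
  then show ?thesis by simp
qed

text \<open>Separates off the pairs at \<open>v\<close>, the only ones affected by recolouring
  \<open>v\<close>.\<close>

lemma card_inner_touching:
  "card inner = card {(i, j)\<in>inner. i \<noteq> v \<and> j \<noteq> v} + 2 * card {j. E v j \<and> c j = c v}"
proof -
  let ?O = "{(i, j)\<in>inner. i \<noteq> v \<and> j \<noteq> v}" and ?D = "{j. E v j \<and> c j = c v}"
  have D: "finite ?D" by (rule finite_subset[of _ "{..<n}"]) (auto dest: E_less)
  have O: "finite ?O" using finite_inner by (rule finite_subset[rotated]) auto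
  have "inner = ?O \<union> (({v} \<times> ?D) \<union> (?D \<times> {v}))"
    by (auto simp: inner_def dest: E_sym)
  then have "card inner = card (?O \<union> (({v} \<times> ?D) \<union> (?D \<times> {v})))" by simp
  also have "\<dots> = card ?O + card (({v} \<times> ?D) \<union> (?D \<times> {v}))"
    using D O by (intro card_Un_disjoint) auto
  also have "card (({v} \<times> ?D) \<union> (?D \<times> {v})) = card ({v} \<times> ?D) + card (?D \<times> {v})"
    using D by (intro card_Un_disjoint) (auto simp: E_irrefl)
  finally show ?thesis by (simp add: card_cartesian_product)
qed

end

text \<open>Recolouring \<open>v\<close> with \<open>l\<close> changes only the monochromatic pairs
  at \<open>v\<close>, and by minimality cannot reduce their number. Two colourings are compared,
  hence two interpretations of the locale.\<close>

lemma minimal_colouring_degrees: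
  assumes "coloured_graph n r E c"
    and min: "\<And>c'. coloured_graph n r E c' \<Longrightarrow>
      card (coloured_graph.inner E c) \<le> card (coloured_graph.inner E c')"
    and v: "v < n" and l: "l < r"
  shows "card (coloured_graph.nbrs n E c v (c v)) \<le> card (coloured_graph.nbrs n E c v l)"
proof (cases "l = c v")
  case True
  then show ?thesis by simp
next
  case False
  interpret C: coloured_graph n r E c by fact
  let ?c = "c(v := l)"
  interpret D: coloured_graph n r E ?c
    using C.graph C.colour l by unfold_locales auto
  have "{(i, j)\<in>D.inner. i \<noteq> v \<and> j \<noteq> v} = {(i, j)\<in>C.inner. i \<noteq> v \<and> j \<noteq> v}"
    by (auto simp: C.inner_def D.inner_def)
  moreover have "{j. E v j \<and> ?c j = ?c v} = C.nbrs v l"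
    using C.E_irrefl C.E_less False by (auto simp: C.nbrs_def C.part_def)
  moreover have "{j. E v j \<and> c j = c v} = C.nbrs v (c v)"
    using C.E_less by (auto simp: C.nbrs_def C.part_def)
  ultimately show ?thesis
    using min[OF D.coloured_graph_axioms] C.card_inner_touching[of v] D.card_inner_touching[of v]
    by simp
qed

section \<open>Gaps forced by the absence of a clique\<close>

locale clique_free_coloured_graph = coloured_graph +
  assumes clique_free: "\<not> contains_clique n E (r + 1)"
begin

text \<open>Colours separate the values of \<open>\<phi>\<close>, so these and \<open>Q\<close> are
  \<open>r + 1\<close> distinct vertices; a complete transversal would make them a clique.\<close>

lemma clique_transversal:
  assumes Q: "Q \<subseteq> {..<n}" "\<And>p q. p \<in> Q \<Longrightarrow> q \<in> Q \<Longrightarrow> p \<noteq> q \<Longrightarrow> E p q"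
    and K: "finite K" "card Q + card K = r + 1"
    and \<phi>: "\<And>k. k \<in> K \<Longrightarrow> \<phi> k \<in> part k" "\<And>k q. k \<in> K \<Longrightarrow> q \<in> Q \<Longrightarrow> E q (\<phi> k)"
  shows "\<exists>k\<in>K. \<exists>l\<in>K. k \<noteq> l \<and> \<not> E (\<phi> k) (\<phi> l)"
proof (rule ccontr)
  assume no: "\<not> ?thesis"
  have "inj_on \<phi> K" by (rule inj_on_inverseI[of _ c]) (use \<phi>(1) in \<open>auto simp: part_def\<close>)
  then have "card (\<phi> ` K) = card K" by (rule card_image)
  moreover have "Q \<inter> \<phi> ` K = {}" using \<phi>(2) E_irrefl by auto
  moreover have "finite Q" using Q(1) by (rule finite_subset) simp
  ultimately have "card (Q \<union> \<phi> ` K) = r + 1" using K by (simp add: card_Un_disjoint)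
  moreover have "Q \<union> \<phi> ` K \<subseteq> {0..<n}" using Q(1) \<phi>(1) by (auto simp: part_def)
  moreover have "\<forall>x\<in>Q \<union> \<phi> ` K. \<forall>y\<in>Q \<union> \<phi> ` K. x \<noteq> y \<longrightarrow> E x y"
    using Q(2) no \<phi>(2) E_sym by auto
  ultimately have "contains_clique n E (r + 1)" unfolding contains_clique_def by (intro exI conjI)
  then show False using clique_free by simp
qed

text \<open>Feeds clique-freeness into the double counting; the factor 2 restores both orders.
  \<open>Q\<close> will be a vertex, with all \<open>r\<close> classes, or a monochromatic edge,
  with the other \<open>r - 1\<close>. A single class makes \<open>P\<close> vacuous, which is why
  \<open>ne\<close> stands apart.\<close>

lemma transversal_gaps:
  assumes Q: "Q \<subseteq> {..<n}" "\<And>p q. p \<in> Q \<Longrightarrow> q \<in> Q \<Longrightarrow> p \<noteq> q \<Longrightarrow> E p q"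
    and K: "finite K" "K \<noteq> {}" "card Q + card K = r + 1"
    and U: "U \<subseteq> {..<n}"
    and X: "\<And>k. k \<in> K \<Longrightarrow> X k \<subseteq> U \<inter> part k" "\<And>k q. k \<in> K \<Longrightarrow> q \<in> Q \<Longrightarrow> X k \<subseteq> {u. E q u}"
    and ne: "\<And>k. k \<in> K \<Longrightarrow> X k \<noteq> {}"
    and P: "\<And>k l. k \<in> K \<Longrightarrow> l \<in> K \<Longrightarrow> k \<noteq> l \<Longrightarrow> P \<le> real (card (X k)) * real (card (X l))"
  shows "2 * P \<le> real (card (gaps U))"
proof -
  have "P \<le> real (card {(x, y). x \<in> U \<and> y \<in> U \<and> c x < c y \<and> \<not> E x y})"
  proof (rule transversal_nonedges[where X = X and K = K])
    show "finite U" using U by (rule finite_subset) simp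
    show "X k \<subseteq> {u\<in>U. c u = k}" if "k \<in> K" for k using X(1)[OF that] by (auto simp: part_def)
    show "\<exists>k\<in>K. \<exists>l\<in>K. k \<noteq> l \<and> \<not> E (\<phi> k) (\<phi> l)" if "\<And>k. k \<in> K \<Longrightarrow> \<phi> k \<in> X k" for \<phi>
      by (rule clique_transversal[OF Q K(1,3)]) (use that X in blast)+
  qed (use K ne P E_sym in auto)
  moreover have "{(x, y). x \<in> U \<and> y \<in> U \<and> c x < c y \<and> \<not> E x y} = {(x, y)\<in>gaps U. c x < c y}"
    by (auto simp: gaps_def)
  moreover have "card (gaps U) = 2 * card {(x, y)\<in>gaps U. c x < c y}"
    using finite_gaps[OF U] by (rule card_symmetric_pairs) (auto simp: gaps_def dest: E_sym)
  ultimately show ?thesis by simp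
qed

text \<open>\<open>B\<close> will be empty or the set of exceptional vertices; in the latter case
  the gaps found avoid \<open>B\<close> and add to those at \<open>B\<close>.\<close>

lemma nbrs_gaps:
  assumes "r > 0" and v: "v < n"
    and ne: "\<And>k. k < r \<Longrightarrow> nbrs v k - B \<noteq> {}"
    and P: "\<And>k l. k < r \<Longrightarrow> l < r \<Longrightarrow> k \<noteq> l \<Longrightarrow>
      P \<le> real (card (nbrs v k - B)) * real (card (nbrs v l - B))"
  shows "2 * P \<le> real (card (gaps ({..<n} - B)))"
proof (rule transversal_gaps[where Q = "{v}" and K = "{..<r}" and X = "\<lambda>k. nbrs v k - B"])
  show "nbrs v k - B \<subseteq> ({..<n} - B) \<inter> part k" for k by (auto simp: nbrs_def part_def)
  show "nbrs v k - B \<subseteq> {u. E q u}" if "q \<in> {v}" for k q using that by (auto simp: nbrs_def)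
  show "P \<le> real (card (nbrs v k - B)) * real (card (nbrs v l - B))"
    if "k \<in> {..<r}" "l \<in> {..<r}" "k \<noteq> l" for k l using that by (intro P) auto
qed (use assms(1) v ne in auto)

text \<open>If both ends shared more than \<open>p\<close> neighbours in every other class, no
  transversal of these could be complete, which would force more than \<open>2 * p\<^sup>2\<close>
  gaps.\<close>

lemma inner_edge_common_nbrs:
  assumes r: "r \<ge> 2" and uv: "E u v" "c u = c v" and p: "p \<ge> 0" "real (card (gaps {..<n})) \<le> 2 * p\<^sup>2"
  shows "\<exists>l<r. l \<noteq> c u \<and> real (card (nbrs u l \<inter> nbrs v l)) \<le> p"
proof (rule ccontr)
  assume no: "\<not> ?thesis"
  define K where "K = {..<r} - {c u}"
  \<comment> \<open>The next integer above \<open>p\<close>: cardinalities exceeding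
    \<open>p\<close> are at least \<open>m\<close>, so the final contradiction is strict.\<close>
  define m where "m = real_of_int \<lfloor>p\<rfloor> + 1"
  have m: "p < m" by (simp add: m_def)
  have big: "m \<le> real (card (nbrs u l \<inter> nbrs v l))" if "l \<in> K" for l
  proof -
    have "p < real (card (nbrs u l \<inter> nbrs v l))" using that no by (auto simp: K_def not_le)
    then have "\<lfloor>p\<rfloor> < int (card (nbrs u l \<inter> nbrs v l))" by (simp add: floor_less_iff)
    then show ?thesis by (simp add: m_def)
  qed
  have u: "c u < r" "u \<noteq> v" "u < n" "v < n" using uv colour E_less E_irrefl by auto
  have "2 * m\<^sup>2 \<le> real (card (gaps {..<n}))"
  proof (rule transversal_gaps[where Q = "{u, v}" and K = K and X = "\<lambda>k. nbrs u k \<inter> nbrs v k"])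
    show "card {u, v} + card K = r + 1" using u r by (simp add: K_def)
    then show "K \<noteq> {}" using u r by auto
    show "nbrs u k \<inter> nbrs v k \<noteq> {}" if "k \<in> K" for k using big[OF that] m p by auto
    show "m\<^sup>2 \<le> real (card (nbrs u k \<inter> nbrs v k)) * real (card (nbrs u l \<inter> nbrs v l))"
      if "k \<in> K" "l \<in> K" for k l
      unfolding power2_eq_square using big that m p by (intro mult_mono) auto
  qed (use u uv E_sym in \<open>auto simp: K_def nbrs_def part_def\<close>)
  then have "m\<^sup>2 \<le> p\<^sup>2" using p by simp
  then show False using m p by (simp add: power_mono_iff)
qed

lemma part_le_nbrs_gap: "l \<noteq> c v \<Longrightarrow> card (part l) \<le> card (nbrs v l) + card (gap v)"
proof -
  assume "l \<noteq> c v"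
  then have "part l \<subseteq> nbrs v l \<union> gap v" by (auto simp: part_def nbrs_def gap_def)
  then have "card (part l) \<le> card (nbrs v l \<union> gap v)" by (intro card_mono) auto
  then show ?thesis using card_Un_le[of "nbrs v l" "gap v"] by linarith
qed

lemma part_le_common_nbrs_gap:
  "l \<noteq> c u \<Longrightarrow> c u = c v \<Longrightarrow> card (part l) \<le> card (nbrs u l \<inter> nbrs v l) + card (gap u) + card (gap v)"
proof -
  assume "l \<noteq> c u" "c u = c v"
  then have "part l \<subseteq> (nbrs u l \<inter> nbrs v l \<union> gap u) \<union> gap v" by (auto simp: part_def nbrs_def gap_def)
  then have "card (part l) \<le> card ((nbrs u l \<inter> nbrs v l \<union> gap u) \<union> gap v)" by (intro card_mono) auto
  then show ?thesis
    using card_Un_le[of "nbrs u l \<inter> nbrs v l \<union> gap u" "gap v"]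
      card_Un_le[of "nbrs u l \<inter> nbrs v l" "gap u"] by linarith
qed

lemma card_inner_le_cover:
  assumes L: "L \<subseteq> {..<n}" and cover: "\<And>i j. E i j \<Longrightarrow> c i = c j \<Longrightarrow> i \<in> L \<or> j \<in> L"
  shows "card inner \<le> 2 * (\<Sum>v\<in>L. card (nbrs v (c v)))"
proof -
  define S where "S = Sigma L (\<lambda>v. nbrs v (c v))"
  have fL: "finite L" using L by (rule finite_subset) simp
  have fS: "finite S" unfolding S_def using fL by (intro finite_SigmaI) auto
  have "inner \<subseteq> S \<union> prod.swap ` S"
    using cover E_sym E_less by (fastforce simp: inner_def S_def nbrs_def part_def image_iff)
  then have "card inner \<le> card (S \<union> prod.swap ` S)" using fS by (intro card_mono) auto
  also have "\<dots> \<le> card S + card (prod.swap ` S)" by (rule card_Un_le)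
  also have "card (prod.swap ` S) \<le> card S" using fS by (rule card_image_le)
  also have "card S = (\<Sum>v\<in>L. card (nbrs v (c v)))" unfolding S_def using fL by simp
  finally show ?thesis by simp
qed

text \<open>The gaps meeting \<open>B\<close> are those starting in \<open>B\<close> and their
  reversals; the two families overlap only in \<open>B \<times> B\<close>, hence the term
  \<open>(card B)\<^sup>2\<close>.\<close>

lemma gaps_touching:
  assumes B: "B \<subseteq> {..<n}"
  shows "2 * (\<Sum>v\<in>B. card (gap v)) + card (gaps ({..<n} - B)) \<le> card (gaps {..<n}) + (card B)\<^sup>2"
proof -
  define S where "S = Sigma B gap"
  have fB: "finite B" using B by (rule finite_subset) simp
  have fS: "finite S" unfolding S_def using fB by (intro finite_SigmaI) auto
  have sub: "S \<union> prod.swap ` S \<subseteq> gaps {..<n}" and disj: "(S \<union> prod.swap ` S) \<inter> gaps ({..<n} - B) = {}"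
    using B E_sym by (auto simp: S_def gap_def gaps_def)
  have "card (gaps ({..<n} - B) \<union> (S \<union> prod.swap ` S)) \<le> card (gaps {..<n})"
    using sub finite_gaps[of "{..<n}"] by (intro card_mono) (auto simp: gaps_def)
  moreover have "card (gaps ({..<n} - B) \<union> (S \<union> prod.swap ` S))
      = card (gaps ({..<n} - B)) + card (S \<union> prod.swap ` S)"
    using fS finite_gaps[of "{..<n} - B"] disj by (intro card_Un_disjoint) auto
  moreover have "card S + card (prod.swap ` S) = card (S \<union> prod.swap ` S) + card (S \<inter> prod.swap ` S)"
    using fS by (intro card_Un_Int) auto
  moreover have "card (prod.swap ` S) = card S" by (rule card_image) simp
  moreover have "card (S \<inter> prod.swap ` S) \<le> card (B \<times> B)"
    using fB by (intro card_mono) (auto simp: S_def)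
  moreover have "card S = (\<Sum>v\<in>B. card (gap v))" unfolding S_def using fB by simp
  ultimately show ?thesis by (simp add: card_cartesian_product power2_eq_square)
qed

end

section \<open>Monochromatic edges of an optimal colouring\<close>

lemma cubic_le:
  fixes a u :: real
  assumes "0 \<le> a" "0 \<le> u"
  shows "a * (u\<^sup>2 - a\<^sup>2) \<le> 2 / (3 * sqrt 3) * u ^ 3"
proof -
  define w where "w = u / sqrt 3"
  have u: "u = sqrt 3 * w" by (simp add: w_def)
  have w: "w \<ge> 0" using assms by (simp add: w_def)
  have sq: "sqrt 3 ^ 3 = 3 * sqrt (3 :: real)" by (simp add: power3_eq_cube)
  have rhs: "2 / (3 * sqrt 3) * u ^ 3 = 2 * w ^ 3"
    unfolding u power_mult_distrib sq by simp
  have lhs: "a * (u\<^sup>2 - a\<^sup>2) = 3 * a * w\<^sup>2 - a ^ 3"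
    unfolding u power_mult_distrib by (simp add: power2_eq_square power3_eq_cube algebra_simps)
  \<comment> \<open>The maximum over \<open>a\<close> is at \<open>a = w = u / sqrt 3\<close>, hence
    the double root of the difference there; this is the source of
    \<open>2 / (3 * sqrt 3)\<close>.\<close>
  have "0 \<le> (a - w)\<^sup>2 * (a + 2 * w)" using assms w by simp
  also have "\<dots> = 2 * w ^ 3 - (3 * a * w\<^sup>2 - a ^ 3)"
    by (simp add: power2_eq_square power3_eq_cube algebra_simps)
  finally show ?thesis unfolding rhs lhs by simp
qed

text \<open>The \<open>o(1)\<close> term will be this times \<open>\<delta> powr (1/4)\<close>. The
  bracket comes from expanding \<open>(1 + C * s) ^ 3\<close> with \<open>s \<le> 1\<close>, and
  \<open>32 * r\<close> from the edges at vertices of \<open>L\<close> outside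
  \<open>B\<close>.\<close>

definition error_const :: "real \<Rightarrow> real" where
  "error_const r = (let C = 304 * r\<^sup>2
     in 2 * r / (3 * sqrt 3) * (3 * C + 3 * C\<^sup>2 + C ^ 3) + 32 * r)"

text \<open>Quantities scaled by powers of \<open>n\<close>: \<open>A\<close> is the largest
  own-class degree of an exceptional vertex, \<open>b\<close> the number of such vertices,
  \<open>G\<close> and \<open>I\<close> count gaps and monochromatic pairs. The bounds on
  \<open>G\<close> give \<open>b / r + A\<^sup>2 \<le> s ^ 4 + C * s ^ 5\<close>, which limits the
  product \<open>A * b\<close>.\<close>

lemma normalised_inner_bound:
  fixes r s A b G I :: real
  assumes r: "r \<ge> 2" and s: "0 \<le> s" "s \<le> 1" and A: "0 \<le> A" "A \<le> 2 * s\<^sup>2"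
    and b: "0 \<le> b" "b \<le> 16 * r * s ^ 4"
    and G: "2 * b * (1 / r - 3 * s) - b\<^sup>2 + 2 * (A\<^sup>2 - 2 * A * b) \<le> G"
    and I: "G \<le> I + 2 * s ^ 4" "I \<le> 2 * A * b + 64 * r * s ^ 7"
  shows "I / 2 \<le> (2 * r / (3 * sqrt 3) + error_const r * s) * s ^ 6"
proof -
  define C where "C = 304 * r\<^sup>2"
  have C: "C \<ge> 0" by (simp add: C_def)
  have pow: "s ^ 6 \<le> s ^ 5" "s ^ 7 \<le> s ^ 5" "s ^ 8 \<le> s ^ 5"
    using s by (auto intro: power_decreasing)
  have rr: "r \<le> r\<^sup>2" using r by (simp add: power2_eq_square)
  have "A * b \<le> (2 * s\<^sup>2) * (16 * r * s ^ 4)" using A b r s by (intro mult_mono) auto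
  also have "\<dots> = 32 * r * s ^ 6" by (simp add: power_add[symmetric])
  also have "\<dots> \<le> 32 * r * s ^ 5" using pow r by (intro mult_left_mono) auto
  finally have Ab: "A * b \<le> 32 * (r * s ^ 5)" by simp
  have "s * b \<le> s * (16 * r * s ^ 4)" using b s by (intro mult_left_mono) auto
  also have "\<dots> = 16 * (r * s ^ 5)" by (simp add: eval_nat_numeral)
  finally have sb: "s * b \<le> 16 * (r * s ^ 5)" .
  have "b\<^sup>2 \<le> (16 * r * s ^ 4)\<^sup>2" using b by (intro power_mono) auto
  also have "\<dots> = 256 * r\<^sup>2 * s ^ 8" by (simp add: power_mult_distrib flip: power_mult)
  also have "\<dots> \<le> 256 * r\<^sup>2 * s ^ 5" using pow by (intro mult_left_mono) auto
  finally have bb: "b\<^sup>2 \<le> 256 * (r\<^sup>2 * s ^ 5)" by simp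
  have r7: "r * s ^ 7 \<le> r * s ^ 5" using pow r by (intro mult_left_mono) auto
  have r5: "r * s ^ 5 \<le> r\<^sup>2 * s ^ 5" using rr s by (intro mult_right_mono) auto
  have "2 * b * (1 / r - 3 * s) = 2 * (b / r) - 6 * (s * b)" by (simp add: algebra_simps)
  then have "2 * (b / r) + 2 * A\<^sup>2 \<le> 2 * s ^ 4 + 6 * (s * b) + b\<^sup>2 + 6 * (A * b) + 64 * (r * s ^ 7)"
    using G I by (simp add: algebra_simps)
  \<comment> \<open>With \<open>r\<close> bounded by \<open>r\<^sup>2\<close> the errors total
    \<open>6 * 16 + 256 + 6 * 32 + 64 = 2 * 304\<close>.\<close>
  also have "\<dots> \<le> 2 * s ^ 4 + 2 * (304 * (r\<^sup>2 * s ^ 5))" using Ab sb bb r7 r5 by linarith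
  finally have T: "b / r + A\<^sup>2 \<le> s ^ 4 + C * s ^ 5" by (simp add: C_def)
  \<comment> \<open>\<open>u\<^sup>2\<close> dominates the right side of \<open>T\<close> without a
    square root, and \<open>u ^ 3\<close> is \<open>s ^ 6\<close> up to a factor
    \<open>(1 + C * s) ^ 3\<close>.\<close>
  define u where "u = s\<^sup>2 * (1 + C * s)"
  have u0: "u \<ge> 0" using C s by (simp add: u_def)
  have "u\<^sup>2 = (s ^ 4 + C * s ^ 5) + (C * s ^ 5 + C\<^sup>2 * s ^ 6)"
    by (simp add: u_def eval_nat_numeral algebra_simps)
  moreover have "0 \<le> C * s ^ 5 + C\<^sup>2 * s ^ 6" using C s by simp
  ultimately have "b / r \<le> u\<^sup>2 - A\<^sup>2" using T by linarith
  then have "b \<le> r * (u\<^sup>2 - A\<^sup>2)" using r by (simp add: pos_divide_le_eq mult.commute)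
  then have "A * b \<le> A * (r * (u\<^sup>2 - A\<^sup>2))" using A(1) by (rule mult_left_mono)
  also have "\<dots> = r * (A * (u\<^sup>2 - A\<^sup>2))" by simp
  also have "\<dots> \<le> r * (2 / (3 * sqrt 3) * u ^ 3)"
    using cubic_le[OF A(1) u0] r by (intro mult_left_mono) auto
  finally have main: "A * b \<le> 2 * r / (3 * sqrt 3) * u ^ 3" by simp
  have "u ^ 3 = s ^ 6 * (1 + (3 * C * s + 3 * C\<^sup>2 * s\<^sup>2 + C ^ 3 * s ^ 3))"
    by (simp add: u_def eval_nat_numeral algebra_simps)
  also have "\<dots> \<le> s ^ 6 * (1 + (3 * C * s + 3 * C\<^sup>2 * s + C ^ 3 * s))"
  proof -
    have "s\<^sup>2 \<le> s" "s ^ 3 \<le> s"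
      using s power_decreasing[of 1 2 s] power_decreasing[of 1 3 s] by auto
    then have "3 * C\<^sup>2 * s\<^sup>2 \<le> 3 * C\<^sup>2 * s" "C ^ 3 * s ^ 3 \<le> C ^ 3 * s"
      using C by (auto intro!: mult_left_mono)
    then show ?thesis using s by (intro mult_left_mono) auto
  qed
  also have "\<dots> = s ^ 6 * (1 + (3 * C + 3 * C\<^sup>2 + C ^ 3) * s)" by (simp add: algebra_simps)
  finally have "2 * r / (3 * sqrt 3) * u ^ 3
      \<le> 2 * r / (3 * sqrt 3) * (s ^ 6 * (1 + (3 * C + 3 * C\<^sup>2 + C ^ 3) * s))"
    using r by (intro mult_left_mono) auto
  then have "I / 2 \<le> 2 * r / (3 * sqrt 3) * (s ^ 6 * (1 + (3 * C + 3 * C\<^sup>2 + C ^ 3) * s)) + 32 * r * s ^ 7"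
    using main I(2) by linarith
  also have "\<dots> = (2 * r / (3 * sqrt 3) + error_const r * s) * s ^ 6"
    unfolding error_const_def Let_def C_def[symmetric] power_Suc2[of s 6, simplified]
    by (simp add: distrib_left distrib_right mult_ac)
  finally show ?thesis .
qed

section \<open>The sharp estimate for an optimal colouring\<close>

context clique_free_coloured_graph
begin

text \<open>\<open>s\<close> stands for the fourth root of \<open>\<delta>\<close>. Recolouring
  enters through \<open>opt\<close>, the spectral hypothesis through \<open>edges\<close> and
  \<open>inner\<close>.\<close>

lemma inner_bound:
  fixes s :: real
  assumes r: "r \<ge> 2" and n: "n > 0" and s: "0 < s" "8 * real r * s\<^sup>2 \<le> 1"
    and opt: "\<And>v l. v < n \<Longrightarrow> l < r \<Longrightarrow> card (nbrs v (c v)) \<le> card (nbrs v l)"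
    and edges: "(1 - 1 / real r - 2 * s ^ 4) * (real n)\<^sup>2 \<le> real (card {(i, j). E i j})"
    and inner: "real (card inner) \<le> 2 * s ^ 4 * (real n)\<^sup>2"
  shows "real (card inner) / 2
    \<le> (2 * real r / (3 * sqrt 3) + error_const (real r) * s) * s ^ 6 * (real n)\<^sup>2"
proof -
  define N where "N = real n"
  define R where "R = real r"
  define G where "G = real (card (gaps {..<n}))"
  define I where "I = real (card inner)"
  define a where "a v = real (card (nbrs v (c v)))" for v
  define g where "g v = real (card (gap v))" for v
  have N: "N > 0" and R: "R \<ge> 2" using n r by (simp_all add: N_def R_def)
  have s2: "s\<^sup>2 \<le> 1 / (8 * R)" using s(2) R by (simp add: R_def field_simps)
  have s1: "s \<le> 1"
  proof -
    have "1 / (8 * R) \<le> 1" using R by simp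
    then have "s\<^sup>2 \<le> 1" using s2 by linarith
    then show ?thesis using s(1) by (simp add: power_le_one_iff abs_square_le_1)
  qed
  \<comment> \<open>Gaps and squared deviations together are at most
    \<open>4 * s ^ 4 * N\<^sup>2\<close>, which yields both \<open>G4\<close> and the class sizes in
    \<open>part\<close>.\<close>
  have dev: "G + (\<Sum>l<r. (real (card (part l)) - N / R)\<^sup>2) \<le> I + 2 * s ^ 4 * N\<^sup>2"
    using variance_count edges r unfolding G_def I_def N_def R_def by (simp add: algebra_simps)
  have dev0: "0 \<le> (\<Sum>l<r. (real (card (part l)) - N / R)\<^sup>2)" by (intro sum_nonneg) simp
  have GI: "G \<le> I + 2 * s ^ 4 * N\<^sup>2" using dev dev0 by linarith
  have G4: "G \<le> 4 * s ^ 4 * N\<^sup>2" using GI inner by (simp add: I_def N_def)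
  have part: "N / R - 2 * s\<^sup>2 * N \<le> real (card (part l))" if "l < r" for l
  proof -
    have "(real (card (part l)) - N / R)\<^sup>2 \<le> (\<Sum>l<r. (real (card (part l)) - N / R)\<^sup>2)"
      using that by (intro member_le_sum) auto
    also have "\<dots> \<le> 4 * s ^ 4 * N\<^sup>2"
      using dev inner by (simp add: I_def N_def G_def)
    also have "\<dots> = (2 * s\<^sup>2 * N)\<^sup>2" by (simp add: power_mult_distrib flip: power_mult)
    finally have "\<bar>real (card (part l)) - N / R\<bar> \<le> 2 * s\<^sup>2 * N"
      using N by (intro power2_le_imp_le[of "\<bar>_\<bar>"]) auto
    then show ?thesis by linarith
  qed
  \<comment> \<open>The ends of a monochromatic edge have at least
    \<open>N / R - 4 * s\<^sup>2 * N \<ge> N / (2 * R)\<close> gaps together, so one of them reaches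
    this threshold.\<close>
  define L where "L = {v. v < n \<and> N / (4 * R) \<le> g v}"
  have L: "L \<subseteq> {..<n}" "finite L" by (auto simp: L_def)
  have cardL: "real (card L) \<le> 16 * R * s ^ 4 * N"
  proof -
    have "real (card L) * (N / (4 * R)) \<le> (\<Sum>v\<in>L. g v)"
      using sum_bounded_below[of L "N / (4 * R)" g] by (simp add: L_def)
    also have "\<dots> \<le> (\<Sum>v<n. g v)" using L by (intro sum_mono2) (auto simp: g_def)
    also have "\<dots> = G" by (simp add: G_def g_def card_gaps_sum)
    also have "\<dots> \<le> 4 * s ^ 4 * N\<^sup>2" by (rule G4)
    also have "\<dots> = (16 * R * s ^ 4 * N) * (N / (4 * R))"
      using R by (simp add: power2_eq_square)
    finally show ?thesis by (rule mult_right_le_imp_le) (use N R in simp)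
  qed
  have cover: "i \<in> L \<or> j \<in> L" if ij: "E i j" "c i = c j" for i j
  proof -
    \<comment> \<open>For \<open>p = 2 * s\<^sup>2 * N\<close> one has
      \<open>2 * p\<^sup>2 = 8 * s ^ 4 * N\<^sup>2 \<ge> G\<close>, as needed for the lemma on
      common neighbours.\<close>
    have "2 * (2 * s\<^sup>2 * N)\<^sup>2 = 2 * (4 * s ^ 4 * N\<^sup>2)"
      by (simp add: power_mult_distrib flip: power_mult)
    moreover have "0 \<le> 4 * s ^ 4 * N\<^sup>2" by simp
    ultimately have "G \<le> 2 * (2 * s\<^sup>2 * N)\<^sup>2" using G4 by linarith
    then obtain l where l: "l < r" "l \<noteq> c i" "real (card (nbrs i l \<inter> nbrs j l)) \<le> 2 * s\<^sup>2 * N"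
      using inner_edge_common_nbrs[OF r ij, of "2 * s\<^sup>2 * N"] N unfolding G_def by auto
    have "real (card (part l)) \<le> real (card (nbrs i l \<inter> nbrs j l)) + g i + g j"
      using part_le_common_nbrs_gap[OF l(2) ij(2)] by (simp add: g_def flip: of_nat_add)
    then have "N / R - 4 * (s\<^sup>2 * N) \<le> g i + g j" using l(3) part[OF l(1)] by linarith
    moreover have "s\<^sup>2 * N \<le> 1 / (8 * R) * N" using s2 N by (intro mult_right_mono) auto
    moreover have "N / R = 8 * (1 / (8 * R) * N)" "N / (4 * R) = 2 * (1 / (8 * R) * N)" by simp_all
    ultimately have "N / (4 * R) \<le> g i \<or> N / (4 * R) \<le> g j" by linarith
    then show ?thesis using E_less[OF ij(1)] by (auto simp: L_def)
  qed
  have "card inner \<le> 2 * (\<Sum>v\<in>L. card (nbrs v (c v)))"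
    using L(1) cover by (rule card_inner_le_cover)
  then have "I \<le> real (2 * (\<Sum>v\<in>L. card (nbrs v (c v))))" unfolding I_def of_nat_le_iff .
  then have I_sum: "I \<le> 2 * (\<Sum>v\<in>L. a v)" by (simp add: a_def)
  \<comment> \<open>By \<open>opt\<close>, \<open>v\<close> has at least \<open>a v\<close>
    neighbours in every class, and of any two classes one differs from its own and so has at least
    \<open>q\<close>. If \<open>a v = 0\<close>, neighbour sets may be empty, so that case is split
    off.\<close>
  have a_prod: "2 * (a v * q) \<le> G"
    if v: "v < n" and q: "\<And>l. l < r \<Longrightarrow> l \<noteq> c v \<Longrightarrow> q \<le> real (card (nbrs v l))" "q \<ge> 0" for v q
  proof (cases "a v = 0")
    case True
    then show ?thesis by (simp add: G_def)
  next
    case False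
    have le: "a v \<le> real (card (nbrs v l))" if "l < r" for l using opt[OF v that] by (simp add: a_def)
    have "2 * (a v * q) \<le> real (card (gaps ({..<n} - {})))"
    proof (rule nbrs_gaps)
      show "nbrs v k - {} \<noteq> {}" if "k < r" for k
        using le[OF that] False by (auto simp: a_def)
      show "a v * q \<le> real (card (nbrs v k - {})) * real (card (nbrs v l - {}))"
        if kl: "k < r" "l < r" "k \<noteq> l" for k l
      proof (cases "l = c v")
        case True
        then have "q * a v \<le> real (card (nbrs v k)) * real (card (nbrs v l))"
          using kl q le by (intro mult_mono) (auto simp: a_def)
        then show ?thesis by (simp add: mult.commute)
      next
        case False
        then have "a v * q \<le> real (card (nbrs v k)) * real (card (nbrs v l))"
          using kl q le by (intro mult_mono) (auto simp: a_def)
        then show ?thesis by simp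
      qed
    qed (use r v in auto)
    then show ?thesis by (simp add: G_def)
  qed
  have a_small: "a v \<le> 2 * s\<^sup>2 * N" if "v < n" for v
  proof -
    have "2 * (a v * a v) \<le> G" using opt[OF that] by (intro a_prod that) (auto simp: a_def)
    also have "\<dots> \<le> 4 * s ^ 4 * N\<^sup>2" by (rule G4)
    finally have "(a v)\<^sup>2 \<le> 2 * (s ^ 4 * N\<^sup>2)" by (simp add: mult_ac flip: power2_eq_square)
    also have "\<dots> \<le> 4 * (s ^ 4 * N\<^sup>2)" by simp
    also have "\<dots> = (2 * s\<^sup>2 * N)\<^sup>2" by (simp add: power_mult_distrib flip: power_mult)
    finally show ?thesis using N by (intro power2_le_imp_le[of "a v"]) auto
  qed
  \<comment> \<open>With at least \<open>s * N\<close> neighbours in all other classes,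
    \<open>a_prod\<close> forces \<open>a v \<le> 2 * s ^ 3 * N\<close>; with fewer in one of them,
    \<open>v\<close> misses almost that whole class.\<close>
  define B where "B = {v\<in>L. \<exists>l<r. l \<noteq> c v \<and> real (card (nbrs v l)) < s * N}"
  have B: "B \<subseteq> L" "finite B" "B \<subseteq> {..<n}" using L by (auto simp: B_def)
  have aL: "a v \<le> 2 * s ^ 3 * N" if "v \<in> L - B" for v
  proof -
    have "2 * (a v * (s * N)) \<le> G"
    proof (rule a_prod)
      show "v < n" using that L by auto
      show "s * N \<le> real (card (nbrs v l))" if "l < r" "l \<noteq> c v" for l
        using \<open>v \<in> L - B\<close> that unfolding B_def by force
    qed (use N s in simp)
    also have "\<dots> \<le> 4 * s ^ 4 * N\<^sup>2" by (rule G4)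
    also have "\<dots> = 2 * ((2 * s ^ 3 * N) * (s * N))" by (simp add: eval_nat_numeral)
    finally have "a v * (s * N) \<le> (2 * s ^ 3 * N) * (s * N)" by linarith
    then show ?thesis by (rule mult_right_le_imp_le) (use s N in simp)
  qed
  have gB: "N / R - 3 * s * N \<le> g v" if v: "v \<in> B" for v
  proof -
    obtain l where l: "l < r" "l \<noteq> c v" "real (card (nbrs v l)) < s * N"
      using v unfolding B_def by blast
    have "real (card (part l)) \<le> real (card (nbrs v l)) + g v"
      using part_le_nbrs_gap[OF l(2)] by (simp add: g_def flip: of_nat_add)
    moreover have "s\<^sup>2 * N \<le> s * N" using s s1 N by (simp add: power2_eq_square)
    ultimately show ?thesis using l part[OF l(1)] by linarith
  qed
  have "(\<Sum>v\<in>L. a v) = (\<Sum>v\<in>L - B. a v) + (\<Sum>v\<in>B. a v)"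
    using B(1) L(2) by (rule sum.subset_diff)
  moreover have "(\<Sum>v\<in>L - B. a v) \<le> 32 * R * s ^ 7 * N\<^sup>2"
  proof -
    have "(\<Sum>v\<in>L - B. a v) \<le> real (card (L - B)) * (2 * s ^ 3 * N)"
      using aL by (intro sum_bounded_above) auto
    also have "\<dots> \<le> (16 * R * s ^ 4 * N) * (2 * s ^ 3 * N)"
    proof (rule mult_right_mono)
      have "card (L - B) \<le> card L" using L(2) by (intro card_mono) auto
      then show "real (card (L - B)) \<le> 16 * R * s ^ 4 * N" using cardL by linarith
    qed (use s N in simp)
    also have "\<dots> = 32 * R * s ^ 7 * N\<^sup>2" by (simp add: eval_nat_numeral)
    finally show ?thesis .
  qed
  ultimately have I_B: "I \<le> 2 * (\<Sum>v\<in>B. a v) + 64 * R * s ^ 7 * N\<^sup>2" using I_sum by linarith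
  \<comment> \<open>The maximum of \<open>a\<close> over \<open>B\<close>, attained at a vertex; the
    default is 0 if \<open>B\<close> is empty.\<close>
  obtain A where A: "0 \<le> A" "A \<le> 2 * s\<^sup>2 * N" "\<And>v. v \<in> B \<Longrightarrow> a v \<le> A" "A = 0 \<or> (\<exists>v<n. a v = A)"
  proof (cases "B = {}")
    case True
    then show ?thesis using that[of 0] N by simp
  next
    case False
    have "Max (a ` B) \<in> a ` B" using False B by (intro Max_in) auto
    then obtain v where v: "v \<in> B" "a v = Max (a ` B)" by auto
    show ?thesis
    proof (rule that[of "a v"])
      show "a w \<le> a v" if "w \<in> B" for w using v that B by simp
      show "a v = 0 \<or> (\<exists>w<n. a w = a v)" using v B by auto
      show "a v \<le> 2 * s\<^sup>2 * N" using v B by (intro a_small) auto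
    qed (simp add: a_def)
  qed
  define b where "b = real (card B)"
  have "card B \<le> card L" using B L by (intro card_mono)
  then have b: "0 \<le> b" "b \<le> 16 * R * s ^ 4 * N" using cardL by (auto simp: b_def)
  have "(\<Sum>v\<in>B. a v) \<le> real (card B) * A" using A(3) by (rule sum_bounded_above)
  then have I_Ab: "I \<le> 2 * (A * b) + 64 * R * s ^ 7 * N\<^sup>2"
    using I_B unfolding b_def by (simp add: mult.commute)
  \<comment> \<open>At a vertex attaining \<open>A\<close>, each class keeps at least
    \<open>A - b\<close> neighbours outside \<open>B\<close>, and \<open>(A - b)\<^sup>2\<close> is
    at least \<open>A\<^sup>2 - 2 * A * b\<close>. For \<open>A \<le> b\<close> the left side is
    nonpositive.\<close>
  have GB: "2 * (A\<^sup>2 - 2 * A * b) \<le> real (card (gaps ({..<n} - B)))"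
  proof (cases "A \<le> b")
    case True
    then have "A * A \<le> A * b" using A(1) by (rule mult_left_mono)
    moreover have "0 \<le> A * b" using A b by simp
    ultimately have "2 * (A\<^sup>2 - 2 * A * b) \<le> 0" by (simp add: power2_eq_square)
    then show ?thesis by (meson of_nat_0_le_iff order_trans)
  next
    case False
    then obtain v where v: "v < n" "a v = A" using A b by auto
    have big: "A - b \<le> real (card (nbrs v k - B))" if "k < r" for k
    proof -
      have "card (nbrs v k) - card B \<le> card (nbrs v k - B)" by (rule diff_card_le_card_Diff[OF B(2)])
      then show ?thesis using opt[OF v(1) that] v(2) by (simp add: a_def b_def)
    qed
    have "2 * ((A - b) * (A - b)) \<le> real (card (gaps ({..<n} - B)))"
    proof (rule nbrs_gaps)
      show "nbrs v k - B \<noteq> {}" if "k < r" for k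
      proof -
        have "real (card (nbrs v k - B)) > 0" using big[OF that] False by linarith
        then show ?thesis by (metis card.empty of_nat_0 less_irrefl)
      qed
      show "(A - b) * (A - b) \<le> real (card (nbrs v k - B)) * real (card (nbrs v l - B))"
        if "k < r" "l < r" for k l using big that False by (intro mult_mono) auto
    qed (use r v in auto)
    moreover have "2 * ((A - b) * (A - b)) = 2 * (A\<^sup>2 - 2 * A * b) + 2 * b\<^sup>2"
      by (simp add: power2_eq_square algebra_simps)
    moreover have "0 \<le> 2 * b\<^sup>2" by simp
    ultimately show ?thesis by linarith
  qed
  have "b * (N / R - 3 * s * N) \<le> (\<Sum>v\<in>B. g v)"
    using sum_bounded_below[of B, OF gB] by (simp add: b_def)
  moreover have "2 * (\<Sum>v\<in>B. g v) + real (card (gaps ({..<n} - B))) \<le> G + b\<^sup>2"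
  proof -
    have "real (2 * (\<Sum>v\<in>B. card (gap v)) + card (gaps ({..<n} - B))) \<le> real (card (gaps {..<n}) + (card B)\<^sup>2)"
      using gaps_touching[OF B(3)] unfolding of_nat_le_iff .
    then show ?thesis by (simp add: g_def G_def b_def)
  qed
  \<comment> \<open>The trade-off between \<open>A\<close> and \<open>b\<close>: gaps at
    \<open>B\<close> and gaps away from \<open>B\<close> share the budget \<open>G\<close>.\<close>
  ultimately have G_low: "2 * (b * (N / R - 3 * s * N)) - b\<^sup>2 + 2 * (A\<^sup>2 - 2 * A * b) \<le> G"
    using GB by linarith
  have "(I / N\<^sup>2) / 2 \<le> (2 * R / (3 * sqrt 3) + error_const R * s) * s ^ 6"
  proof (rule normalised_inner_bound[where A = "A / N" and b = "b / N" and G = "G / N\<^sup>2"])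
    show "A / N \<le> 2 * s\<^sup>2" "b / N \<le> 16 * R * s ^ 4" using A(2) b(2) N by (simp_all add: pos_divide_le_eq)
    have "2 * (b / N) * (1 / R - 3 * s) - (b / N)\<^sup>2 + 2 * ((A / N)\<^sup>2 - 2 * (A / N) * (b / N))
      = (2 * (b * (N / R - 3 * s * N)) - b\<^sup>2 + 2 * (A\<^sup>2 - 2 * A * b)) / N\<^sup>2"
      using N R by (simp add: field_simps power2_eq_square)
    also have "\<dots> \<le> G / N\<^sup>2" using G_low by (simp add: divide_right_mono)
    finally show "2 * (b / N) * (1 / R - 3 * s) - (b / N)\<^sup>2 + 2 * ((A / N)\<^sup>2 - 2 * (A / N) * (b / N)) \<le> G / N\<^sup>2" .
    have "G / N\<^sup>2 \<le> (I + 2 * s ^ 4 * N\<^sup>2) / N\<^sup>2" using GI by (rule divide_right_mono) simp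
    also have "\<dots> = I / N\<^sup>2 + 2 * s ^ 4" using N by (simp add: add_divide_distrib)
    finally show "G / N\<^sup>2 \<le> I / N\<^sup>2 + 2 * s ^ 4" .
    have "I / N\<^sup>2 \<le> (2 * (A * b) + 64 * R * s ^ 7 * N\<^sup>2) / N\<^sup>2" using I_Ab by (rule divide_right_mono) simp
    also have "\<dots> = 2 * (A / N) * (b / N) + 64 * R * s ^ 7"
      using N by (simp add: add_divide_distrib power2_eq_square)
    finally show "I / N\<^sup>2 \<le> 2 * (A / N) * (b / N) + 64 * R * s ^ 7" .
  qed (use R s s1 A b N in auto)
  then show ?thesis using N by (simp add: I_def N_def R_def field_simps)
qed

end

section \<open>Deletion number, spectral hypothesis and conclusion\<close>

lemma (in coloured_graph) D_r_le: "2 * D_r n E r \<le> card inner"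
proof -
  \<comment> \<open>Deleting the monochromatic edges makes \<open>c\<close> proper, so
    \<open>F\<close> competes in the minimum; \<open>inner\<close> lists each edge of
    \<open>F\<close> in both orders.\<close>
  define F where "F = {{i, j} | i j. E i j \<and> c i = c j}"
  have pairs: "F = (\<lambda>(i, j). {i, j}) ` {(i, j)\<in>inner. i < j}"
  proof
    show "F \<subseteq> (\<lambda>(i, j). {i, j}) ` {(i, j)\<in>inner. i < j}"
    proof
      fix e assume "e \<in> F"
      then obtain i j where e: "e = {i, j}" "E i j" "c i = c j" by (auto simp: F_def)
      then have "i \<noteq> j" using E_irrefl by auto
      then have "i < j \<or> j < i" by linarith
      then show "e \<in> (\<lambda>(i, j). {i, j}) ` {(i, j)\<in>inner. i < j}"
      proof
        assume "i < j"
        then show ?thesis using e by (intro image_eqI[of _ _ "(i, j)"]) (auto simp: inner_def)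
      next
        assume "j < i"
        then show ?thesis using e E_sym by (intro image_eqI[of _ _ "(j, i)"]) (auto simp: inner_def)
      qed
    qed
  qed (auto simp: F_def inner_def)
  have fin: "finite {(i, j)\<in>inner. i < j}" using finite_inner by (rule finite_subset[rotated]) auto
  have "card inner = 2 * card {(i, j)\<in>inner. id i < id j}"
    using finite_inner by (rule card_symmetric_pairs) (auto simp: inner_def E_irrefl dest: E_sym)
  then have cF: "2 * card F \<le> card inner" unfolding pairs using card_image_le[OF fin] by simp
  have "graph_edges E \<subseteq> Pow {..<n}" by (auto simp: graph_edges_def dest: E_less)
  then have "finite (graph_edges E)" by (rule finite_subset) simp
  then have "finite {H. H \<subseteq> graph_edges E}" by (simp add: Collect_mono_iff flip: Pow_def)
  then have "finite {card H | H. H \<subseteq> graph_edges E \<and>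
     (\<exists>c :: nat \<Rightarrow> nat. (\<forall>i<n. c i < r) \<and> (\<forall>i j. E i j \<and> {i, j} \<notin> H \<longrightarrow> c i \<noteq> c j))}"
    by (rule finite_subset[rotated, OF finite_imageI[of _ card]]) auto
  moreover have "F \<subseteq> graph_edges E" by (auto simp: F_def graph_edges_def)
  moreover have "\<forall>i j. E i j \<and> {i, j} \<notin> F \<longrightarrow> c i \<noteq> c j" by (auto simp: F_def)
  ultimately have "D_r n E r \<le> card F" unfolding D_r_def
    using colour by (intro Min_le) blast+
  then show ?thesis using cF by simp
qed

lemma clique_free_colouring:
  fixes y :: "nat \<Rightarrow> real"
  assumes graph: "simple_graph n E" and free: "\<not> contains_clique n E (r + 1)"
    and y: "\<And>i. y i \<ge> 0"
  shows "\<exists>c :: nat \<Rightarrow> nat. (\<forall>i<n. c i < r) \<and>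
    (\<Sum>i<n. \<Sum>j<n. of_bool (E i j) * (1 + of_bool (c i = c j)) * y i * y j)
      \<le> (1 - 1 / real r) * (\<Sum>i<n. y i)\<^sup>2"
proof -
  have "\<exists>c :: nat \<Rightarrow> nat. (\<forall>i\<in>{..<n}. c i < r) \<and>
    (\<Sum>i<n. \<Sum>j<n. of_bool (E i j) * (1 + of_bool (c i = c j)) * y i * y j)
      \<le> (1 - 1 / real r) * (\<Sum>i<n. y i)\<^sup>2"
  proof (rule weighted_colouring)
    show "E j i" if "E i j" for i j using that graph by (simp add: simple_graph_def)
    show "\<not> E i i" for i using graph by (simp add: simple_graph_def)
    show "\<exists>i\<in>S. \<exists>j\<in>S. i \<noteq> j \<and> \<not> E i j" if "S \<subseteq> {..<n}" "card S = Suc r" for S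
      using that free unfolding contains_clique_def by (auto simp: lessThan_atLeast0)
  qed (use y in auto)
  then show ?thesis by (simp only: Ball_def lessThan_iff)
qed

lemma card_pairs_eq_sum:
  fixes n :: nat
  assumes "\<And>i j. P i j \<Longrightarrow> i < n \<and> j < n"
  shows "real (card {(i, j). P i j}) = (\<Sum>i<n. \<Sum>j<n. of_bool (P i j))"
proof -
  have "{(i, j). P i j} = Sigma {..<n} (\<lambda>i. {j. j < n \<and> P i j})" using assms by auto
  then have "card {(i, j). P i j} = (\<Sum>i<n. card {j. j < n \<and> P i j})" by simp
  moreover have "real (card {j. j < n \<and> P i j}) = (\<Sum>j<n. of_bool (P i j))" for i
  proof -
    have "{j. j < n \<and> P i j} = {..<n} \<inter> {j. P i j}" by auto
    then show ?thesis by simp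
  qed
  ultimately show ?thesis by simp
qed

text \<open>Nikiforov's inequality, with the edges counted in both orders. For the weights
  \<open>(x i)\<^sup>2\<close>, dropping the monochromatic surplus from the colouring bound leaves
  Motzkin--Straus.\<close>

lemma spec_rad_sq_le:
  assumes graph: "simple_graph n E" and free: "\<not> contains_clique n E (r + 1)" and n: "n > 0"
  shows "(spec_rad n E)\<^sup>2 \<le> (1 - 1 / real r) * real (card {(i, j). E i j})"
proof -
  have sym: "E j i" if "E i j" for i j using that graph by (simp add: simple_graph_def)
  have less: "i < n \<and> j < n" if "E i j" for i j using that graph by (simp add: simple_graph_def)
  obtain x where x: "\<exists>i<n. x i \<noteq> 0"
    "\<forall>i<n. (\<Sum>j<n. of_bool (E i j) * x j) = spec_rad n E * x i"
    using spec_rad_eigenvector[of n E] n sym by blast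
  obtain c :: "nat \<Rightarrow> nat" where
    "(\<Sum>i<n. \<Sum>j<n. of_bool (E i j) * (1 + of_bool (c i = c j)) * (x i)\<^sup>2 * (x j)\<^sup>2)
      \<le> (1 - 1 / real r) * (\<Sum>i<n. (x i)\<^sup>2)\<^sup>2"
    using clique_free_colouring[OF graph free, of "\<lambda>i. (x i)\<^sup>2"] by auto
  moreover have "(\<Sum>i<n. \<Sum>j<n. of_bool (E i j) * (x i)\<^sup>2 * (x j)\<^sup>2)
      \<le> (\<Sum>i<n. \<Sum>j<n. of_bool (E i j) * (1 + of_bool (c i = c j)) * (x i)\<^sup>2 * (x j)\<^sup>2)"
    by (intro sum_mono mult_right_mono) auto
  ultimately have ms: "(\<Sum>i<n. \<Sum>j<n. of_bool (E i j) * (x i)\<^sup>2 * (x j)\<^sup>2)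
      \<le> (1 - 1 / real r) * (\<Sum>i<n. (x i)\<^sup>2)\<^sup>2" by linarith
  have "(spec_rad n E)\<^sup>2 \<le> (1 - 1 / real r) * (\<Sum>i<n. \<Sum>j<n. of_bool (E i j))"
    by (rule spectral_edge_bound[where x = x]) (use x ms in auto)
  then show ?thesis using card_pairs_eq_sum[of E n] less by simp
qed

text \<open>With \<open>s ^ 4 = \<delta>\<close>, the bound
  \<open>64 * (real r)\<^sup>2 * \<delta> \<le> 1\<close> is the square of the condition
  \<open>8 * real r * s\<^sup>2 \<le> 1\<close> in \<open>inner_bound\<close>.\<close>

lemma D_r_bound:
  fixes \<delta> :: real
  assumes r: "r \<ge> 2" and n: "n > 0" and graph: "simple_graph n E"
    and free: "\<not> contains_clique n E (r + 1)"
    and \<delta>: "0 \<le> \<delta>" "64 * (real r)\<^sup>2 * \<delta> \<le> 1"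
    and spec: "(1 - 1 / real r - \<delta>) * real n \<le> spec_rad n E"
  shows "real (D_r n E r) \<le> (2 * real r / (3 * sqrt 3) + error_const (real r) * \<delta> powr (1/4))
    * \<delta> powr (3/2) * (real n)\<^sup>2"
proof -
  define g where "g = 1 - 1 / real r"
  have g: "1 / 2 \<le> g" using r by (simp add: g_def field_simps)
  \<comment> \<open>This gives \<open>\<delta> \<le> 1 / 256\<close>, so \<open>g - \<delta>\<close>
    is nonnegative and the spectral hypothesis may be squared.\<close>
  have "4 * 1 \<le> (real r)\<^sup>2" using r power_mono[of 2 "real r" 2] by simp
  then have "256 * \<delta> \<le> 64 * (real r)\<^sup>2 * \<delta>" using \<delta>(1) by (intro mult_right_mono) auto
  then have "\<delta> \<le> g" using \<delta> g by linarith
  then have "((g - \<delta>) * real n)\<^sup>2 \<le> (spec_rad n E)\<^sup>2"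
    using spec by (intro power_mono) (auto simp: g_def)
  also have "\<dots> \<le> g * real (card {(i, j). E i j})"
    unfolding g_def by (rule spec_rad_sq_le[OF graph free n])
  finally have "(g - \<delta>)\<^sup>2 * (real n)\<^sup>2 \<le> g * real (card {(i, j). E i j})"
    by (simp add: power_mult_distrib)
  \<comment> \<open>Dropping \<open>\<delta>\<^sup>2\<close> exposes a factor \<open>g\<close> that
    cancels.\<close>
  moreover have "g * ((g - 2 * \<delta>) * (real n)\<^sup>2) \<le> (g - \<delta>)\<^sup>2 * (real n)\<^sup>2"
  proof -
    have "g * (g - 2 * \<delta>) \<le> (g - \<delta>)\<^sup>2" by (simp add: power2_eq_square algebra_simps)
    then have "g * (g - 2 * \<delta>) * (real n)\<^sup>2 \<le> (g - \<delta>)\<^sup>2 * (real n)\<^sup>2" by (rule mult_right_mono) simp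
    then show ?thesis by (simp only: mult.assoc)
  qed
  ultimately have "g * ((g - 2 * \<delta>) * (real n)\<^sup>2) \<le> g * real (card {(i, j). E i j})" by linarith
  then have edges: "(g - 2 * \<delta>) * (real n)\<^sup>2 \<le> real (card {(i, j). E i j})"
    by (rule mult_left_le_imp_le) (use g in simp)
  \<comment> \<open>With unit weights the sum is the edge count plus the monochromatic count, so
    \<open>edges\<close> leaves at most \<open>2 * \<delta> * (real n)\<^sup>2\<close> monochromatic
    pairs.\<close>
  obtain c0 :: "nat \<Rightarrow> nat" where c0: "\<forall>i<n. c0 i < r"
    "(\<Sum>i<n. \<Sum>j<n. of_bool (E i j) * (1 + of_bool (c0 i = c0 j))) \<le> g * (real n)\<^sup>2"
    using clique_free_colouring[OF graph free, of "\<lambda>_. 1"] by (auto simp: g_def)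
  have cg0: "coloured_graph n r E c0" using graph c0(1) by unfold_locales auto
  \<comment> \<open>The best colouring inherits the bound of \<open>c0\<close> and adds the degree
    condition.\<close>
  obtain c where c: "coloured_graph n r E c"
    and min: "\<And>c'. coloured_graph n r E c' \<Longrightarrow>
      card (coloured_graph.inner E c) \<le> card (coloured_graph.inner E c')"
    using ex_has_least_nat[of "coloured_graph n r E" c0 "\<lambda>c. card (coloured_graph.inner E c)"] cg0
    by blast
  interpret C0: coloured_graph n r E c0 by fact
  interpret C: clique_free_coloured_graph n r E c
    using c free by (simp add: clique_free_coloured_graph_def clique_free_coloured_graph_axioms_def)
  have "real (card C0.inner) = (\<Sum>i<n. \<Sum>j<n. of_bool (E i j \<and> c0 i = c0 j))"
    unfolding C0.inner_def by (rule card_pairs_eq_sum) (use C.E_less in blast)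
  then have "real (card {(i, j). E i j}) + real (card C0.inner)
      = (\<Sum>i<n. \<Sum>j<n. of_bool (E i j)) + (\<Sum>i<n. \<Sum>j<n. of_bool (E i j \<and> c0 i = c0 j))"
    using card_pairs_eq_sum[of E n] C.E_less by simp
  also have "\<dots> = (\<Sum>i<n. \<Sum>j<n. of_bool (E i j) * (1 + of_bool (c0 i = c0 j)))"
    unfolding sum.distrib[symmetric] by (intro sum.cong refl) simp
  also have "\<dots> \<le> g * (real n)\<^sup>2" by (rule c0(2))
  finally have "real (card C0.inner) \<le> 2 * \<delta> * (real n)\<^sup>2"
    using edges by (simp add: algebra_simps)
  moreover have "real (card C.inner) \<le> real (card C0.inner)" using min[OF cg0] by simp
  ultimately have inner: "real (card C.inner) \<le> 2 * \<delta> * (real n)\<^sup>2" by linarith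
  have "real (2 * D_r n E r) \<le> real (card C.inner)" using C.D_r_le unfolding of_nat_le_iff .
  then have D: "real (D_r n E r) \<le> real (card C.inner) / 2" by simp
  show ?thesis
  proof (cases "\<delta> = 0")
    case True
    then show ?thesis using D inner by simp
  next
    case False
    define s where "s = \<delta> powr (1/4)"
    have s: "s > 0" using False by (simp add: s_def)
    have s4: "s ^ 4 = \<delta>" and s6: "s ^ 6 = \<delta> powr (3/2)"
      using False \<delta> by (simp_all add: s_def powr_power)
    have "(8 * real r * s\<^sup>2)\<^sup>2 = 64 * (real r)\<^sup>2 * \<delta>"
      unfolding s4[symmetric] by (simp add: power_mult_distrib flip: power_mult)
    then have "(8 * real r * s\<^sup>2)\<^sup>2 \<le> 1\<^sup>2" using \<delta> by simp
    then have "8 * real r * s\<^sup>2 \<le> 1" by (rule power2_le_imp_le) simp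
    then have "real (card C.inner) / 2
      \<le> (2 * real r / (3 * sqrt 3) + error_const (real r) * s) * s ^ 6 * (real n)\<^sup>2"
      using edges inner
      by (intro C.inner_bound r n s minimal_colouring_degrees[OF c min])
        (auto simp: s4 g_def)
    then show ?thesis using D unfolding s6 by (simp add: s_def)
  qed
qed

theorem theorem3p5:
  fixes r :: nat
  assumes "r \<ge> 2"
  shows "\<exists>f :: real \<Rightarrow> real. (f \<longlongrightarrow> 0) (at_right 0) \<and>
    (\<forall>n E \<delta>. simple_graph n E \<longrightarrow> real n \<ge> 3 * real r ^ 2 \<longrightarrow>
       0 \<le> \<delta> \<longrightarrow> \<delta> \<le> 10 powr (-7) * real r powr (-12) \<longrightarrow>
       \<not> contains_clique n E (r + 1) \<longrightarrow>
       spec_rad n E \<ge> (1 - 1 / real r - \<delta>) * real n \<longrightarrow>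
       real (D_r n E r) \<le> (2 * real r / (3 * sqrt 3) + f \<delta>) * \<delta> powr (3/2) * (real n)^2)"
proof (intro exI conjI allI impI)
  have "((\<lambda>\<delta> :: real. \<delta> powr (1/4)) \<longlongrightarrow> 0 powr (1/4)) (at_right 0)"
    by (rule tendsto_powr2) (auto simp: eventually_at_filter)
  then show "((\<lambda>\<delta>. error_const (real r) * \<delta> powr (1/4)) \<longlongrightarrow> 0) (at_right 0)"
    by (intro tendsto_mult_right_zero) simp
next
  fix n E and \<delta> :: real
  assume *: "simple_graph n E" "real n \<ge> 3 * real r ^ 2" "0 \<le> \<delta>"
    "\<delta> \<le> 10 powr (-7) * real r powr (-12)" "\<not> contains_clique n E (r + 1)"
    "spec_rad n E \<ge> (1 - 1 / real r - \<delta>) * real n"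
  have r0: "real r > 0" using assms by simp
  have "0 < 3 * real r ^ 2" using r0 by simp
  then have n: "n > 0" using *(2) by linarith
  have "64 * (real r)\<^sup>2 * \<delta> \<le> 64 * (real r)\<^sup>2 * (10 powr (-7) * real r powr (-12))"
    using *(4) by (intro mult_left_mono) auto
  \<comment> \<open>Crude bounds suffice: \<open>10 powr (-7) \<le> 1 / 64\<close> and
    \<open>real r powr (-12) \<le> real r powr (-2)\<close>.\<close>
  also have "\<dots> \<le> 64 * (real r)\<^sup>2 * (1 / 64 * real r powr (-2))"
    using assms by (intro mult_left_mono mult_mono powr_mono) (auto simp: powr_minus powr_numeral)
  also have "\<dots> = 1" using r0 by (simp add: powr_minus powr_numeral)
  finally show "real (D_r n E r) \<le> (2 * real r / (3 * sqrt 3) + error_const (real r) * \<delta> powr (1/4))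
      * \<delta> powr (3/2) * (real n)^2"
    using D_r_bound[OF assms n *(1,5,3) _ *(6)] by simp
qed

end
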